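(* Let $E$ be an extremally rich JB$^*$-triple. Then the quadratic conorm $\gamma^{q}(\cdot)$ is continuous at a point $a\in E$ if, and only if, either $a$ is not von Neumann regular (i.e. $\gamma^{q}(a)=0$) or $a$ is BP quasi-invertible.
   Context: A JB$^*$-triple is a complex Banach space $E$ with a triple product $\{\cdot,\cdot,\cdot\}:E\times E\times E\to E$ that is linear and symmetric in the outer variables, conjugate linear in the middle variable, and satisfies: (a) $\{x,y,\{a,b,c\}\} = \{\{x,y,a\},b,c\} - \{a,\{y,x,b\},c\} + \{a,b,\{x,y,c\}\}$ for all $a,b,c,x,y\in E$; (b) for each $a\in E$ the operator $L(a,a):x\mapsto\{a,a,x\}$ is a bounded hermitian operator with non-negative spectrum; (c) $\|\{x,x,x\}\|=\|x\|^3$ for all $x\in E$. For $x,y\in E$, put $L(x,y)(z)=\{x,y,z\}$, $Q(x)(z)=\{x,z,x\}$, and let $B(x,y)=I_E-2L(x,y)+Q(x)Q(y)$. An element $x\in E$ is Brown-Pedersen quasi-invertible (BP quasi-invertible) if there exists $y\in E$ with $B(x,y)=0$. $E_q^{-1}$ denotes the set of BP quasi-invertible elements, and $E$ is extremally rich if $E_q^{-1}$ is norm dense in $E$. The reduced minimum modulus of a non-zero bounded linear or conjugate linear operator $T$ between normed spaces is $\gamma(T)=\inf\{\|T(x)\| : \mathrm{dist}(x,\ker(T))\geq 1\}$, and $\gamma(0)=\infty$. The quadratic conorm of $a\in E$ is $\gamma^q(a)=\gamma(Q(a))\in[0,\infty]$. An element $a\in E$ is von Neumann regular if there exists $b\in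 E$ with $Q(a)b=a$, $Q(b)a=b$ and $Q(a)Q(b)=Q(b)Q(a)$. It is known that $a$ is von Neumann regular if and only if $\gamma^q(a)>0$. *)

theory Defs
  imports "HOL-Analysis.Analysis"
begin

text \<open>
  A complex Banach space is a real Banach space (type class \<open>banach\<close>) with a complex scalar
  multiplication \<open>sc\<close> that extends the real one and for which the norm is homogeneous.
\<close>

locale complex_banach_space = vector_space sc
  for sc :: "complex \<Rightarrow> 'a::banach \<Rightarrow> 'a" +
  assumes sc_of_real: "sc (complex_of_real r) x = r *\<^sub>R x"
    and norm_sc: "norm (sc c x) = cmod c * norm x"

definition bounded_clinear :: "(complex \<Rightarrow> 'a::banach \<Rightarrow> 'a) \<Rightarrow> ('a \<Rightarrow> 'a) \<Rightarrow> bool" where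
  "bounded_clinear sc T \<longleftrightarrow> Vector_Spaces.linear sc sc T \<and> bounded_linear T"

definition operator_exp :: "(complex \<Rightarrow> 'a::banach \<Rightarrow> 'a) \<Rightarrow> ('a \<Rightarrow> 'a) \<Rightarrow> 'a \<Rightarrow> 'a" where
  "operator_exp sc T x = (\<Sum>n. sc (1 / fact n) ((T ^^ n) x))"

text \<open>
  \<open>T\<close> is hermitian if \<open>exp (i t T)\<close> is isometric for every real \<open>t\<close>; since these operators
  form a one-parameter group, this is the same as all of them having norm at most one.
\<close>

definition hermitian_operator :: "(complex \<Rightarrow> 'a::banach \<Rightarrow> 'a) \<Rightarrow> ('a \<Rightarrow> 'a) \<Rightarrow> bool" where
  "hermitian_operator sc T \<longleftrightarrow> bounded_clinear sc T \<and>
     (\<forall>(t::real) x. norm (operator_exp sc (\<lambda>y. sc (\<i> * complex_of_real t) (T y)) x) = norm x)"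

definition operator_spectrum :: "(complex \<Rightarrow> 'a::banach \<Rightarrow> 'a) \<Rightarrow> ('a \<Rightarrow> 'a) \<Rightarrow> complex set" where
  "operator_spectrum sc T = {\<mu>. \<not> (\<exists>S. bounded_clinear sc S \<and>
     S \<circ> (\<lambda>x. T x - sc \<mu> x) = id \<and> (\<lambda>x. T x - sc \<mu> x) \<circ> S = id)}"

locale jb_triple = complex_banach_space sc
  for sc :: "complex \<Rightarrow> 'a::banach \<Rightarrow> 'a" +
  fixes tp :: "'a \<Rightarrow> 'a \<Rightarrow> 'a \<Rightarrow> 'a"
  assumes tp_linear: "Vector_Spaces.linear sc sc (\<lambda>x. tp x y z)"
    and tp_commute: "tp x y z = tp z y x"
    and tp_conj_add: "tp x (y + y') z = tp x y z + tp x y' z"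
    and tp_conj_scale: "tp x (sc \<alpha> y) z = sc (cnj \<alpha>) (tp x y z)"
    and jordan_identity:
      "tp x y (tp a b c) = tp (tp x y a) b c - tp a (tp y x b) c + tp a b (tp x y c)"
    and hermitian: "hermitian_operator sc (\<lambda>x. tp a a x)"
    and spectrum_nonneg: "operator_spectrum sc (\<lambda>x. tp a a x) \<subseteq> \<real>\<^sub>\<ge>\<^sub>0"
    and norm_cube: "norm (tp x x x) = norm x ^ 3"

definition L_op :: "('a \<Rightarrow> 'a \<Rightarrow> 'a \<Rightarrow> 'a) \<Rightarrow> 'a \<Rightarrow> 'a \<Rightarrow> 'a \<Rightarrow> 'a" where
  "L_op tp x y z = tp x y z"

definition Q_op :: "('a \<Rightarrow> 'a \<Rightarrow> 'a \<Rightarrow> 'a) \<Rightarrow> 'a \<Rightarrow> 'a \<Rightarrow> 'a" where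
  "Q_op tp x z = tp x z x"

definition bergman_op ::
    "('a::real_vector \<Rightarrow> 'a \<Rightarrow> 'a \<Rightarrow> 'a) \<Rightarrow> 'a \<Rightarrow> 'a \<Rightarrow> 'a \<Rightarrow> 'a" where
  "bergman_op tp x y z = z - 2 *\<^sub>R L_op tp x y z + Q_op tp x (Q_op tp y z)"

definition bp_quasi_invertibles :: "('a::real_vector \<Rightarrow> 'a \<Rightarrow> 'a \<Rightarrow> 'a) \<Rightarrow> 'a set" where
  "bp_quasi_invertibles tp = {x. \<exists>y. bergman_op tp x y = (\<lambda>z. 0)}"

definition extremally_rich :: "('a::real_normed_vector \<Rightarrow> 'a \<Rightarrow> 'a \<Rightarrow> 'a) \<Rightarrow> bool" where
  "extremally_rich tp \<longleftrightarrow> closure (bp_quasi_invertibles tp) = UNIV"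

definition von_neumann_regular :: "('a \<Rightarrow> 'a \<Rightarrow> 'a \<Rightarrow> 'a) \<Rightarrow> 'a \<Rightarrow> bool" where
  "von_neumann_regular tp a \<longleftrightarrow> (\<exists>b. Q_op tp a b = a \<and> Q_op tp b a = b \<and>
     Q_op tp a \<circ> Q_op tp b = Q_op tp b \<circ> Q_op tp a)"

definition reduced_min_modulus ::
    "('a::real_normed_vector \<Rightarrow> 'b::real_normed_vector) \<Rightarrow> ereal" where
  "reduced_min_modulus T = (if T = (\<lambda>x. 0) then \<infinity>
     else INF x \<in> {x. infdist x {y. T y = 0} \<ge> 1}. ereal (norm (T x)))"

text \<open>
  Continuity of the quadratic conorm refers to the usual topology of the extended reals,
  in which \<open>[0, \<infinity>]\<close> carries its order topology.
\<close>

definition quadratic_conorm :: "('a::real_normed_vector \<Rightarrow> 'a \<Rightarrow> 'a \<Rightarrow> 'a) \<Rightarrow> 'a \<Rightarrow> ereal" where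
  "quadratic_conorm tp a = reduced_min_modulus (Q_op tp a)"

end

theory Submission imports Defs
begin

text \<open>
  Write \<open>\<gamma>(a)\<close> for the quadratic conorm. In a Banach space the set of operators whose reduced minimum
  modulus is at least \<open>c\<close> is norm closed, so \<open>\<gamma>\<close> is upper semicontinuous; in particular it is
  continuous where it vanishes. If \<open>B(a,b) = 0\<close>, then also \<open>B(b,a) = 0\<close>, so both Bergman operators stay
  small at \<open>(x,b)\<close> for \<open>x\<close> near \<open>a\<close>, and solving \<open>y = 2b - Q(b)x + B(b,x)y\<close> gives bounded \<open>y\<close> with
  \<open>Q(x)y = x\<close>. Hence \<open>\<gamma>\<close> is bounded away from \<open>0\<close> near \<open>a\<close>, and this forces lower semicontinuity.

  Conversely let \<open>\<gamma>\<close> be continuous at a regular \<open>a\<close> with generalised inverse \<open>b\<close>. Then \<open>\<gamma>(a) > 0\<close>, so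
  BP quasi-invertible \<open>x\<close> near \<open>a\<close> have \<open>y\<close> of bounded norm with \<open>B(x,y) = 0\<close>, and \<open>B(a,y)\<close> is small.
  As \<open>B(a,b)B(a,y)B(a,b) = B(a,b)\<close> for every \<open>y\<close>, this gives \<open>B(a,b) = 0\<close>.

  That \<open>\<gamma>(a) > 0\<close> implies regularity is proved inside the closed real span \<open>F\<close> of the odd powers of \<open>a\<close>.
  There \<open>L(a,a)\<close> has dense range, by a mean ergodic argument for the contraction \<open>cos (t L(a,a))\<close> and
  the identity \<open>\<parallel>{x,x,x}\<parallel> = \<parallel>x\<parallel>^3\<close>. Consequently \<open>Q(x)k = 0\<close> for \<open>x \<in> F\<close> and \<open>k \<in> ker Q(a)\<close>, so
  \<open>\<gamma>(a) > 0\<close> bounds \<open>L(a,a)\<close> from below on \<open>F\<close>, and the solution \<open>b \<in> F\<close> of \<open>{a,a,b} = a\<close> is the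
  generalised inverse of \<open>a\<close>.
\<close>

section \<open>Reduced minimum modulus\<close>

text \<open>A homogeneous, real-valued form of \<open>reduced_min_modulus T \<ge> c\<close>. For
  \<open>T = 0\<close> all distances vanish, so it holds for every \<open>c\<close>, in line with
  the value infinity.\<close>

definition lower_bound_mod :: "('a::real_normed_vector \<Rightarrow> 'b::real_normed_vector) \<Rightarrow> real \<Rightarrow> bool" where
  "lower_bound_mod T c \<longleftrightarrow> (\<forall>u. c * infdist u {y. T y = 0} \<le> norm (T u))"

lemma infdist_less_witness:
  assumes "infdist u S < r" "S \<noteq> {}"
  shows "\<exists>k\<in>S. dist u k < r"
  using assms by (auto simp: infdist_notempty dest!: cInf_lessD[rotated])

lemma infdist_scaleR_kernel:
  fixes T :: "'a::real_normed_vector \<Rightarrow> 'b::real_normed_vector"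
  assumes "linear T" "s > 0"
  shows "infdist (s *\<^sub>R u) {y. T y = 0} = s * infdist u {y. T y = 0}"
proof -
  interpret linear T by fact
  have le: "infdist (s *\<^sub>R u) {y. T y = 0} \<le> s * infdist u {y. T y = 0}" if "s > 0" for s u
  proof -
    have "infdist (s *\<^sub>R u) {y. T y = 0} / s \<le> dist u k" if k: "T k = 0" for k
    proof -
      have "infdist (s *\<^sub>R u) {y. T y = 0} \<le> dist (s *\<^sub>R u) (s *\<^sub>R k)"
        by (rule infdist_le) (simp add: scale k)
      also have "\<dots> = s * dist u k"
        using \<open>s > 0\<close> by (simp add: dist_norm flip: scaleR_diff_right)
      finally show ?thesis using \<open>s > 0\<close> by (simp add: field_simps)
    qed
    moreover have "{y. T y = 0} \<noteq> {}" using zero by blast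
    ultimately have "infdist (s *\<^sub>R u) {y. T y = 0} / s \<le> infdist u {y. T y = 0}"
      unfolding infdist_notempty[OF \<open>{y. T y = 0} \<noteq> {}\<close>] by (intro cINF_greatest) auto
    then show ?thesis using \<open>s > 0\<close> by (simp add: field_simps)
  qed
  \<comment> \<open>The reverse inequality is the same bound, for the factor
    \<open>inverse s\<close> at the vector \<open>s *\<^sub>R u\<close>.\<close>
  have "infdist (inverse s *\<^sub>R (s *\<^sub>R u)) {y. T y = 0} \<le> inverse s * infdist (s *\<^sub>R u) {y. T y = 0}"
    using \<open>s > 0\<close> by (intro le) auto
  then have "s * infdist u {y. T y = 0} \<le> infdist (s *\<^sub>R u) {y. T y = 0}"
    using \<open>s > 0\<close> by (simp add: field_simps)
  with le[OF \<open>s > 0\<close>, of u] show ?thesis by simp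
qed

text \<open>Vectors at positive distance from the kernel are rescaled to distance 1; at distance 0
  the bound is trivial.\<close>

lemma le_reduced_min_modulus_iff:
  assumes "linear T" "c \<ge> 0"
  shows "ereal c \<le> reduced_min_modulus T \<longleftrightarrow> lower_bound_mod T c"
proof (cases "T = (\<lambda>x. 0)")
  case True
  then show ?thesis by (simp add: reduced_min_modulus_def lower_bound_mod_def)
next
  case False
  interpret linear T by fact
  have "lower_bound_mod T c" if bd: "\<And>x. infdist x {y. T y = 0} \<ge> 1 \<Longrightarrow> c \<le> norm (T x)"
    unfolding lower_bound_mod_def
  proof
    fix u
    define d where "d = infdist u {y. T y = 0}"
    show "c * infdist u {y. T y = 0} \<le> norm (T u)"
    proof (cases "d = 0")
      case False
      then have "d > 0" using infdist_nonneg[of u "{y. T y = 0}"] by (simp add: d_def)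
      then have "infdist (inverse d *\<^sub>R u) {y. T y = 0} = 1"
        by (subst infdist_scaleR_kernel) (auto simp: assms d_def)
      then have "c \<le> norm (T (inverse d *\<^sub>R u))" by (intro bd) simp
      then show ?thesis using \<open>d > 0\<close> by (simp add: scale field_simps flip: d_def)
    qed (simp add: d_def)
  qed
  moreover have "c \<le> norm (T x)" if "lower_bound_mod T c" "infdist x {y. T y = 0} \<ge> 1" for x
  proof -
    have "c * 1 \<le> c * infdist x {y. T y = 0}" using that assms by (intro mult_left_mono) auto
    also have "\<dots> \<le> norm (T x)" using that by (simp add: lower_bound_mod_def)
    finally show ?thesis by simp
  qed
  ultimately show ?thesis using False
    by (auto simp: reduced_min_modulus_def le_INF_iff)
qed

lemma reduced_min_modulus_nonneg: "reduced_min_modulus T \<ge> 0"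
  by (auto simp: reduced_min_modulus_def intro!: INF_greatest)

lemma lower_bound_modD:
  assumes "lower_bound_mod T c" "linear T" "c > 0" "norm (T u) < c * r"
  shows "\<exists>k. T k = 0 \<and> norm (u - k) < r"
proof -
  have "c * infdist u {y. T y = 0} < c * r"
    using assms unfolding lower_bound_mod_def by (meson le_less_trans)
  then have "infdist u {y. T y = 0} < r" using assms by simp
  moreover have "{y. T y = 0} \<noteq> {}" using linear_0[OF \<open>linear T\<close>] by auto
  ultimately show ?thesis using infdist_less_witness[of u "{y. T y = 0}" r]
    by (auto simp: dist_norm)
qed

lemma lower_bound_modI:
  assumes "c > 0" "\<And>u \<epsilon>. \<epsilon> > 0 \<Longrightarrow> \<exists>k. T k = 0 \<and> c * norm (u - k) \<le> norm (T u) + \<epsilon>"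
  shows "lower_bound_mod T c"
  unfolding lower_bound_mod_def
proof (rule allI, rule field_le_epsilon)
  fix u and \<epsilon> :: real assume "\<epsilon> > 0"
  then obtain k where k: "T k = 0" "c * norm (u - k) \<le> norm (T u) + \<epsilon>"
    using assms(2) by blast
  have "c * infdist u {y. T y = 0} \<le> c * norm (u - k)"
    using \<open>c > 0\<close> infdist_le[of k "{y. T y = 0}" u] k by (intro mult_left_mono) (auto simp: dist_norm)
  with k show "c * infdist u {y. T y = 0} \<le> norm (T u) + \<epsilon>" by linarith
qed

text \<open>Successive approximation: a kernel vector of a nearby \<open>S\<close> is almost
  annihilated by \<open>T\<close>. Repeating the correction with geometrically decreasing errors
  gives a Cauchy sequence, whose limit is a genuine kernel vector of \<open>T\<close>.\<close>

lemma lower_bound_mod_limit: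
  fixes T :: "'a::banach \<Rightarrow> 'b::real_normed_vector"
  assumes T: "bounded_linear T" and "c > 0"
    and approx: "\<And>\<eta>. \<eta> > 0 \<Longrightarrow>
      \<exists>S. linear S \<and> lower_bound_mod S c \<and> (\<forall>v. norm (S v - T v) \<le> \<eta> * norm v)"
  shows "lower_bound_mod T c"
proof (rule lower_bound_modI[OF \<open>c > 0\<close>])
  fix u :: 'a and \<epsilon> :: real assume "\<epsilon> > 0"
  interpret bounded_linear T by fact
  have step: "\<exists>v'. c * norm (v - v') \<le> norm (T v) + \<theta> \<and> norm (T v') \<le> \<theta>" if "\<theta> > 0" for v \<theta>
  proof -
    \<comment> \<open>\<open>S\<close> must be chosen before its kernel vector \<open>k\<close> is
      known; \<open>R\<close> bounds in advance both \<open>v\<close> and every \<open>k\<close>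
      that can arise.\<close>
    define R where "R = 2 * norm v + (norm (T v) + \<theta>) / c + 1"
    have R: "R > 0" "norm v \<le> R"
      using \<open>\<theta> > 0\<close> \<open>c > 0\<close> by (auto simp: R_def intro!: add_nonneg_pos add_nonneg_nonneg)
    then obtain S where S: "linear S" "lower_bound_mod S c" "\<And>v. norm (S v - T v) \<le> (\<theta> / (2 * R)) * norm v"
      using approx[of "\<theta> / (2 * R)"] \<open>\<theta> > 0\<close> by auto
    have small: "norm (S w - T w) \<le> \<theta> / 2" if "norm w \<le> R" for w
    proof -
      have "norm (S w - T w) \<le> (\<theta> / (2 * R)) * norm w" by (rule S)
      also have "\<dots> \<le> (\<theta> / (2 * R)) * R"
        using that R \<open>\<theta> > 0\<close> by (intro mult_left_mono) auto
      finally show ?thesis using R by simp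
    qed
    have "norm (S v) \<le> norm (T v) + norm (S v - T v)" by (rule norm_triangle_sub)
    with small[OF R(2)] \<open>\<theta> > 0\<close> have "norm (S v) < norm (T v) + \<theta>" by linarith
    then have "norm (S v) < c * ((norm (T v) + \<theta>) / c)" using \<open>c > 0\<close> by simp
    from lower_bound_modD[OF S(2,1) \<open>c > 0\<close> this]
    obtain k where k: "S k = 0" "norm (v - k) < (norm (T v) + \<theta>) / c" by blast
    have "norm k \<le> norm v + norm (v - k)" by (metis norm_minus_commute norm_triangle_sub)
    with k have "norm k \<le> R" unfolding R_def using norm_ge_zero[of v] by linarith
    from small[OF this] k(1) have "norm (T k) \<le> \<theta> / 2" by simp
    moreover have "c * norm (v - k) \<le> norm (T v) + \<theta>"
      using k(2) \<open>c > 0\<close> by (simp add: field_simps)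
    ultimately show ?thesis using \<open>\<theta> > 0\<close> by (intro exI[of _ k]) auto
  qed
  define \<theta> where "\<theta> n = (\<epsilon> / 4) * (1/2) ^ n" for n
  have \<theta>_pos: "\<theta> n > 0" for n using \<open>\<epsilon> > 0\<close> by (simp add: \<theta>_def)
  obtain v where v0: "v 0 = u"
    and v: "\<And>n. c * norm (v n - v (Suc n)) \<le> norm (T (v n)) + \<theta> n \<and> norm (T (v (Suc n))) \<le> \<theta> n"
    using dependent_nat_choice[of "\<lambda>n v. n = 0 \<longrightarrow> v = u"
        "\<lambda>n v v'. c * norm (v - v') \<le> norm (T v) + \<theta> n \<and> norm (T v') \<le> \<theta> n"] step[OF \<theta>_pos]
    by auto
  \<comment> \<open>\<open>b n\<close> bounds the cost of move \<open>n\<close>: the first starts at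
    \<open>u\<close>, the later ones where \<open>norm (T (v n)) \<le> \<theta> (n - 1)\<close>.
    Every error is paid twice, hence the factor \<open>\<epsilon> / 4\<close>.\<close>
  define b where "b n = (if n = 0 then norm (T u) + \<theta> 0 else \<theta> (n - 1) + \<theta> n)" for n
  have \<theta>_sums: "\<theta> sums (\<epsilon> / 2)"
    unfolding \<theta>_def using sums_mult[OF geometric_sums[of "1/2::real"], of "\<epsilon> / 4"] by simp
  have b_sums: "b sums (norm (T u) + \<epsilon>)"
  proof -
    have "(\<lambda>n. if n = 0 then norm (T u) else \<theta> (n - 1)) sums (\<epsilon> / 2 + norm (T u))"
      using sums_Suc_iff[of "\<lambda>n. if n = 0 then norm (T u) else \<theta> (n - 1)" "\<epsilon> / 2"] \<theta>_sums by simp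
    moreover have "b = (\<lambda>n. (if n = 0 then norm (T u) else \<theta> (n - 1)) + \<theta> n)"
      by (auto simp: b_def)
    moreover have "norm (T u) + \<epsilon> = \<epsilon> / 2 + norm (T u) + \<epsilon> / 2" by simp
    ultimately show ?thesis using sums_add[OF _ \<theta>_sums] by metis
  qed
  have b: "c * norm (v (Suc n) - v n) \<le> b n" for n
    using v[of n] v[of "n - 1"] v0 by (cases n) (auto simp: b_def norm_minus_commute)
  have summ_n: "summable (\<lambda>n. norm (v (Suc n) - v n))"
  proof (rule summable_comparison_test)
    show "\<exists>N. \<forall>n\<ge>N. norm (norm (v (Suc n) - v n)) \<le> b n / c"
      using b \<open>c > 0\<close> by (auto simp: field_simps)
    show "summable (\<lambda>n. b n / c)" using b_sums by (intro summable_divide) (auto simp: sums_iff)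
  qed
  then have "summable (\<lambda>n. v (Suc n) - v n)" by (rule summable_norm_cancel)
  then have "(\<lambda>n. \<Sum>i<n. v (Suc i) - v i) \<longlonglongrightarrow> (\<Sum>n. v (Suc n) - v n)"
    by (rule summable_LIMSEQ)
  then have "(\<lambda>n. (v n - u) + u) \<longlonglongrightarrow> (\<Sum>n. v (Suc n) - v n) + u"
    by (intro tendsto_intros) (simp add: sum_lessThan_telescope v0)
  then obtain k where k: "v \<longlonglongrightarrow> k" and k_eq: "k - u = (\<Sum>n. v (Suc n) - v n)" by auto
  have "(\<lambda>n. T (v (Suc n))) \<longlonglongrightarrow> T k"
    using k by (intro tendsto LIMSEQ_Suc)
  moreover have "(\<lambda>n. T (v (Suc n))) \<longlonglongrightarrow> 0"
  proof (rule Lim_null_comparison)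
    show "\<theta> \<longlonglongrightarrow> 0" using \<theta>_sums by (auto simp: sums_iff intro: summable_LIMSEQ_zero)
    show "\<forall>\<^sub>F n in sequentially. norm (T (v (Suc n))) \<le> \<theta> n" using v by auto
  qed
  ultimately have "T k = 0" by (rule LIMSEQ_unique)
  moreover have "c * norm (u - k) \<le> norm (T u) + \<epsilon>"
  proof -
    have "norm (u - k) \<le> (\<Sum>n. norm (v (Suc n) - v n))"
      using summable_norm[OF summ_n] by (simp add: norm_minus_commute[of u] k_eq)
    then have "c * norm (u - k) \<le> (\<Sum>n. c * norm (v (Suc n) - v n))"
      using \<open>c > 0\<close> summ_n by (simp add: suminf_mult)
    also have "\<dots> \<le> suminf b"
      using b b_sums summ_n by (intro suminf_le) (auto simp: sums_iff intro: summable_mult)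
    finally show ?thesis using b_sums by (simp add: sums_iff)
  qed
  ultimately show "\<exists>k. T k = 0 \<and> c * norm (u - k) \<le> norm (T u) + \<epsilon>" by blast
qed

text \<open>Moving a vector between the two kernels costs only a multiple of the distance of the
  operators, because both reduced minimum moduli are bounded away from zero.\<close>

lemma lower_bound_mod_perturb:
  assumes "0 < c" "c < c'" "0 < \<delta>"
  shows "\<exists>\<eta>>0. \<forall>S T. linear S \<longrightarrow> linear T \<longrightarrow> lower_bound_mod T c' \<longrightarrow> lower_bound_mod S \<delta> \<longrightarrow>
    (\<forall>v. norm (S v - T v) \<le> \<eta> * norm v) \<longrightarrow>
    lower_bound_mod (S :: 'a::real_normed_vector \<Rightarrow> 'b::real_normed_vector) c"
proof -
  \<comment> \<open>Solves \<open>(c + 2 * \<eta>) / c' + 4 * \<eta> / \<delta> = 1\<close>. Moving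
    into the kernel of \<open>T\<close> costs the first summand times \<open>d\<close>, moving back
    into that of \<open>S\<close> the second; the estimate there gives 3, and 4 makes it
    strict.\<close>
  define \<eta> where "\<eta> = (1 - c / c') / (2 / c' + 4 / \<delta>)"
  have c': "c' > 0" using assms by simp
  have "\<eta> > 0" unfolding \<eta>_def using assms c' by (intro divide_pos_pos add_pos_pos) simp_all
  have "2 / c' + 4 / \<delta> > 0" using assms c' by (intro add_pos_pos) auto
  then have "\<eta> * (2 / c' + 4 / \<delta>) = 1 - c / c'" by (simp add: \<eta>_def)
  then have \<eta>_sum: "(c + 2 * \<eta>) / c' + 4 * \<eta> / \<delta> = 1" by (simp add: algebra_simps add_divide_distrib)
  have \<eta>_le: "(c + 2 * \<eta>) / c' \<le> 1"
    using \<eta>_sum divide_pos_pos[of "4 * \<eta>" \<delta>] \<open>\<eta> > 0\<close> \<open>\<delta> > 0\<close> by linarith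
  have "lower_bound_mod S c"
    if S: "linear S" "lower_bound_mod S \<delta>" and T: "linear T" "lower_bound_mod T c'"
      and close: "\<And>v. norm (S v - T v) \<le> \<eta> * norm v"
    for S T :: "'a \<Rightarrow> 'b"
    unfolding lower_bound_mod_def
  proof (rule allI, rule ccontr)
    fix u
    define d where "d = infdist u {y. S y = 0}"
    assume "\<not> c * infdist u {y. S y = 0} \<le> norm (S u)"
    then have u: "norm (S u) < c * d" by (simp add: d_def)
    then have "c * d > 0" using norm_ge_zero[of "S u"] by linarith
    then have "d > 0" using \<open>c > 0\<close> by (simp add: zero_less_mult_iff)
    have ker_ne: "{y. S y = 0} \<noteq> {}" using linear_0[OF S(1)] by auto
    obtain k0 where k0: "S k0 = 0" "norm (u - k0) < 2 * d"
      using infdist_less_witness[of u "{y. S y = 0}" "2 * d"] \<open>d > 0\<close> ker_ne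
      by (auto simp: d_def dist_norm)
    \<comment> \<open>The operators are close only relative to the norm of the argument, and
      \<open>u\<close> may be large compared with \<open>d\<close>; \<open>u'\<close> has norm below
      \<open>2 * d\<close>.\<close>
    define u' where "u' = u - k0"
    have Su': "S u' = S u" by (simp add: u'_def linear_diff[OF S(1)] k0)
    have "norm (T u') \<le> norm (S u') + norm (S u' - T u')"
      using norm_triangle_sub[of "T u'" "S u'"] by (simp add: norm_minus_commute)
    also have "norm (S u' - T u') \<le> \<eta> * (2 * d)"
      using order_trans[OF close[of u'] mult_left_mono[of "norm u'" "2 * d" \<eta>]] k0(2) \<open>\<eta> > 0\<close>
      by (simp add: u'_def)
    finally have "norm (T u') < c * d + \<eta> * (2 * d)" using u Su' by simp
    also have "\<dots> = c' * ((c + 2 * \<eta>) / c' * d)" using c' by (simp add: field_simps)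
    finally obtain k where k: "T k = 0" "norm (u' - k) < (c + 2 * \<eta>) / c' * d"
      using lower_bound_modD[OF T(2,1) c'] by blast
    have "(c + 2 * \<eta>) / c' * d \<le> d" using mult_right_mono[OF \<eta>_le, of d] \<open>d > 0\<close> by simp
    then have "norm (u' - k) < d" using k(2) by linarith
    moreover have "norm k \<le> norm (u - k0) + norm (u' - k)"
      using norm_triangle_sub[of k u'] by (simp add: u'_def norm_minus_commute)
    ultimately have "norm k \<le> 3 * d" using k0(2) by linarith
    then have "norm (S k) \<le> \<eta> * (3 * d)"
      using order_trans[OF close[of k] mult_left_mono[of "norm k" "3 * d" \<eta>]] k(1) \<open>\<eta> > 0\<close> by simp
    also have "\<dots> < \<delta> * (4 * \<eta> / \<delta> * d)" using \<open>\<eta> > 0\<close> \<open>d > 0\<close> \<open>\<delta> > 0\<close> by simp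
    finally obtain k' where k': "S k' = 0" "norm (k - k') < 4 * \<eta> / \<delta> * d"
      using lower_bound_modD[OF S(2,1) \<open>\<delta> > 0\<close>] by blast
    have "norm (u' - k') \<le> norm (u' - k) + norm (k - k')"
      using dist_triangle[of u' k' k] by (simp add: dist_norm)
    also have "\<dots> < ((c + 2 * \<eta>) / c' + 4 * \<eta> / \<delta>) * d"
      using k(2) k'(2) by (simp add: distrib_right)
    finally have "norm (u' - k') < d" unfolding \<eta>_sum by simp
    then have "dist u (k0 + k') < d" by (simp add: u'_def dist_norm algebra_simps)
    moreover have "d \<le> dist u (k0 + k')"
      unfolding d_def by (rule infdist_le) (simp add: linear_add[OF S(1)] k0 k')
    ultimately show False by simp
  qed
  with \<open>\<eta> > 0\<close> show ?thesis by blast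
qed

section \<open>Boundedness of the triple product\<close>

context jb_triple
begin

lemma sc_add: "sc c (x + y) = sc c x + sc c y" and sc_diff: "sc c (x - y) = sc c x - sc c y"
  and sc_minus: "sc c (- x) = - sc c x" and sc_sc: "sc c (sc d x) = sc (c * d) x"
  and sc_one: "sc 1 x = x" and sc_minus_left: "sc (- c) x = - sc c x"
  by (simp_all add: scale_right_distrib scale_right_diff_distrib)

lemma tp_add_left: "tp (x + x') y z = tp x y z + tp x' y z"
  and tp_sc_left: "tp (sc c x) y z = sc c (tp x y z)"
  using tp_linear[of y z] unfolding Vector_Spaces.linear_iff by blast+

lemma tp_add_right: "tp x y (z + z') = tp x y z + tp x y z'"
  and tp_sc_right: "tp x y (sc c z) = sc c (tp x y z)"
  by (metis tp_commute tp_add_left) (metis tp_commute tp_sc_left)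

lemma tp_scaleR_left: "tp (r *\<^sub>R x) y z = r *\<^sub>R tp x y z"
  and tp_scaleR_mid: "tp x (r *\<^sub>R y) z = r *\<^sub>R tp x y z"
  and tp_scaleR_right: "tp x y (r *\<^sub>R z) = r *\<^sub>R tp x y z"
  by (simp_all add: tp_sc_left tp_sc_right tp_conj_scale flip: sc_of_real)

lemma linear_tp_left: "linear (\<lambda>x. tp x y z)"
  and linear_tp_mid: "linear (\<lambda>y. tp x y z)"
  and linear_tp_right: "linear (\<lambda>z. tp x y z)"
  by (auto intro!: linearI simp: tp_add_left tp_conj_add tp_add_right
      tp_scaleR_left tp_scaleR_mid tp_scaleR_right)

lemmas tp_zero_left [simp] = linear_0[OF linear_tp_left]
lemmas tp_zero_mid [simp] = linear_0[OF linear_tp_mid]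
lemmas tp_zero_right [simp] = linear_0[OF linear_tp_right]
lemmas tp_minus_left = linear_neg[OF linear_tp_left]
lemmas tp_minus_mid = linear_neg[OF linear_tp_mid]
lemmas tp_minus_right = linear_neg[OF linear_tp_right]
lemmas tp_diff_left = linear_diff[OF linear_tp_left]
lemmas tp_diff_mid = linear_diff[OF linear_tp_mid]
lemmas tp_diff_right = linear_diff[OF linear_tp_right]

lemmas tp_simps = tp_add_left tp_conj_add tp_add_right tp_minus_left tp_minus_mid tp_minus_right
  tp_diff_left tp_diff_mid tp_diff_right tp_scaleR_left tp_scaleR_mid tp_scaleR_right

text \<open>Averaging the cubes of \<open>x + \<omega>y\<close> over the fourth roots of unity \<open>\<omega>\<close> isolates the term \<open>{x,y,x}\<close>, so
  the norm axiom alone makes the triple product jointly continuous.\<close>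

lemma tp_polarization_middle:
  "4 *\<^sub>R tp x y x = tp (x + y) (x + y) (x + y) - tp (x - y) (x - y) (x - y)
     + sc \<i> (tp (x + sc \<i> y) (x + sc \<i> y) (x + sc \<i> y))
     - sc \<i> (tp (x - sc \<i> y) (x - sc \<i> y) (x - sc \<i> y))"
proof -
  have four: "4 *\<^sub>R v = v + v + v + v" for v :: 'a
    by (metis (no_types) add.assoc numeral_Bit0 scaleR_2 scaleR_add_left)
  show ?thesis
    unfolding four
    by (simp add: tp_add_left tp_conj_add tp_add_right tp_diff_left tp_diff_mid tp_diff_right
        tp_sc_left tp_sc_right tp_conj_scale sc_add sc_diff sc_minus sc_sc sc_minus_left sc_one algebra_simps)
qed

lemma norm_tp_middle_le: "norm (tp x y x) \<le> (norm x + norm y) ^ 3"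
proof -
  have c: "norm (tp u u u) \<le> (norm x + norm y) ^ 3" if "norm u \<le> norm x + norm y" for u
    using that by (auto simp: norm_cube intro: power_mono)
  have "norm (4 *\<^sub>R tp x y x) \<le> 4 * (norm x + norm y) ^ 3"
    unfolding tp_polarization_middle
  proof -
    have n: "norm (sc \<i> y) = norm y" by (simp add: norm_sc)
    have "norm (p - q + sc \<i> r - sc \<i> s) \<le> norm p + norm q + norm r + norm s" for p q r s
    proof -
      have "norm (p - q + sc \<i> r - sc \<i> s) \<le> norm p + norm q + norm (sc \<i> r) + norm (sc \<i> s)"
        by (meson add_mono norm_triangle_ineq norm_triangle_ineq4 order_refl order_trans)
      then show ?thesis by (simp add: norm_sc)
    qed
    note this[of "tp (x + y) (x + y) (x + y)" "tp (x - y) (x - y) (x - y)"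
        "tp (x + sc \<i> y) (x + sc \<i> y) (x + sc \<i> y)" "tp (x - sc \<i> y) (x - sc \<i> y) (x - sc \<i> y)"]
    moreover note c[OF norm_triangle_ineq] c[OF norm_triangle_ineq4]
      c[of "x + sc \<i> y"] c[of "x - sc \<i> y"]
      norm_triangle_ineq[of x "sc \<i> y"] norm_triangle_ineq4[of x "sc \<i> y"]
    ultimately show "norm (tp (x + y) (x + y) (x + y) - tp (x - y) (x - y) (x - y)
     + sc \<i> (tp (x + sc \<i> y) (x + sc \<i> y) (x + sc \<i> y))
     - sc \<i> (tp (x - sc \<i> y) (x - sc \<i> y) (x - sc \<i> y))) \<le> 4 * (norm x + norm y) ^ 3"
      unfolding n by linarith
  qed
  then show ?thesis by simp
qed

text \<open>For unit vectors \<open>x + z\<close> and \<open>x - z\<close> have norm at most 2.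
  Halving them gives the cube bound 8, scaling back 32, and polarization in the outer variables
  \<open>(32 + 32) / 4 = 16\<close>.\<close>

lemma norm_tp_le: "norm (tp x y z) \<le> 16 * norm x * norm y * norm z"
proof -
  have unit: "norm (tp x y z) \<le> 16" if "norm x = 1" "norm y = 1" "norm z = 1" for x y z
  proof -
    have mid: "norm (tp u y u) \<le> 32" if "norm u \<le> 2" for u
    proof -
      define v where "v = (1/2) *\<^sub>R u"
      have "norm v \<le> 1" using that by (simp add: v_def)
      then have "norm (tp v y v) \<le> 2 ^ 3"
        using order_trans[OF norm_tp_middle_le[of v y] power_mono[of "norm v + norm y" 2 3]]
          \<open>norm y = 1\<close> by simp
      moreover have "tp u y u = 4 *\<^sub>R tp v y v" by (simp add: v_def tp_simps)
      ultimately show ?thesis by simp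
    qed
    have "4 *\<^sub>R tp x y z = tp (x + z) y (x + z) - tp (x - z) y (x - z)"
    proof -
      have four: "4 *\<^sub>R v = v + v + v + v" for v :: 'a
        by (metis (no_types) add.assoc numeral_Bit0 scaleR_2 scaleR_add_left)
      show ?thesis unfolding four using tp_commute[of z y x] by (simp add: tp_simps)
    qed
    also have "norm \<dots> \<le> 32 + 32"
      using mid[of "x + z"] mid[of "x - z"] norm_triangle_ineq[of x z] norm_triangle_ineq4[of x z] that
      by (intro order_trans[OF norm_triangle_ineq4] add_mono) auto
    finally show ?thesis by simp
  qed
  show ?thesis
  proof (cases "x = 0 \<or> y = 0 \<or> z = 0")
    case False
    define u where "u v = (1 / norm v) *\<^sub>R v" for v :: 'a
    have u: "v = norm v *\<^sub>R u v" "norm (u v) = 1" if "v \<noteq> 0" for v using that by (auto simp: u_def)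
    have "tp x y z = tp (norm x *\<^sub>R u x) (norm y *\<^sub>R u y) (norm z *\<^sub>R u z)"
      using False u(1) by metis
    then have "norm (tp x y z) = norm x * norm y * norm z * norm (tp (u x) (u y) (u z))"
      by (simp add: tp_simps)
    also have "\<dots> \<le> norm x * norm y * norm z * 16"
      using False u(2) unit by (intro mult_left_mono) auto
    finally show ?thesis by (simp add: mult_ac)
  qed auto
qed

lemma bounded_linear_tp_left: "bounded_linear (\<lambda>x. tp x y z)"
  and bounded_linear_tp_mid: "bounded_linear (\<lambda>y. tp x y z)"
  and bounded_linear_tp_right: "bounded_linear (\<lambda>z. tp x y z)"
proof -
  show "bounded_linear (\<lambda>x. tp x y z)"
    by (rule bounded_linear_intro[where K = "16 * norm y * norm z"])
      (use norm_tp_le[of _ y z] in \<open>auto simp: tp_simps mult_ac\<close>)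
  show "bounded_linear (\<lambda>y. tp x y z)"
    by (rule bounded_linear_intro[where K = "16 * norm x * norm z"])
      (use norm_tp_le[of x _ z] in \<open>auto simp: tp_simps mult_ac\<close>)
  show "bounded_linear (\<lambda>z. tp x y z)"
    by (rule bounded_linear_intro[where K = "16 * norm x * norm y"])
      (use norm_tp_le[of x y] in \<open>auto simp: tp_simps mult_ac\<close>)
qed

lemma tp_tendsto:
  assumes "(f \<longlongrightarrow> x) F" "(g \<longlongrightarrow> y) F" "(h \<longlongrightarrow> z) F"
  shows "((\<lambda>t. tp (f t) (g t) (h t)) \<longlongrightarrow> tp x y z) F"
proof -
  have 1: "((\<lambda>t. tp (f t - x) (g t) (h t)) \<longlongrightarrow> 0) F"
  proof (rule Lim_null_comparison)
    show "\<forall>\<^sub>F t in F. norm (tp (f t - x) (g t) (h t)) \<le> 16 * norm (f t - x) * norm (g t) * norm (h t)"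
      by (simp add: norm_tp_le)
    show "((\<lambda>t. 16 * norm (f t - x) * norm (g t) * norm (h t)) \<longlongrightarrow> 0) F"
      by (rule tendsto_eq_intros assms refl | simp)+
  qed
  have 2: "((\<lambda>t. tp x (g t - y) (h t)) \<longlongrightarrow> 0) F"
  proof (rule Lim_null_comparison)
    show "\<forall>\<^sub>F t in F. norm (tp x (g t - y) (h t)) \<le> 16 * norm x * norm (g t - y) * norm (h t)"
      by (simp add: norm_tp_le)
    show "((\<lambda>t. 16 * norm x * norm (g t - y) * norm (h t)) \<longlongrightarrow> 0) F"
      by (rule tendsto_eq_intros assms refl | simp)+
  qed
  have 3: "((\<lambda>t. tp x y (h t)) \<longlongrightarrow> tp x y z) F"
    by (rule bounded_linear.tendsto[OF bounded_linear_tp_right assms(3)])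
  have "tp (f t) (g t) (h t) = tp (f t - x) (g t) (h t) + tp x (g t - y) (h t) + tp x y (h t)" for t
    by (simp add: tp_simps)
  with tendsto_add[OF tendsto_add[OF 1 2] 3] show ?thesis by simp
qed

end

section \<open>Jordan identities and Peirce projections\<close>

context jb_triple
begin

text \<open>In the notation of the proof, two instances of the Jordan identity say
  \<open>R + S = 2P\<close> and \<open>P + S = 2R\<close>, so \<open>3(R - P) = 0\<close>.\<close>

lemma L_Q_commute: "tp x y (tp x z x) = tp x (tp y x z) x"
proof -
  define P R S where "P = tp x z (tp x y x)" and "R = tp x y (tp x z x)" and "S = tp x (tp y x z) x"
  have 1: "R = P - S + P"
    using jordan_identity[of x y x z x] by (simp add: P_def R_def S_def tp_commute[of "tp x y x"])
  have 2: "P = R - S + R"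
    using jordan_identity[of x z x y x]
    by (simp add: P_def R_def S_def tp_commute[of "tp x z x"] tp_commute[of z x y])
  have RS: "R + S = P + P" using 1 by (metis add_diff_eq diff_add_cancel diff_add_eq)
  have PS: "P + S = R + R" using 2 by (metis add_diff_eq diff_add_cancel diff_add_eq)
  have "R - P = (R + S) - (P + S)" by simp
  also have "\<dots> = - (2 *\<^sub>R (R - P))"
    unfolding RS PS by (simp add: scaleR_2)
  finally have "(1 + 2) *\<^sub>R (R - P) = 0"
    unfolding scaleR_add_left by (simp only: eq_neg_iff_add_eq_0 scaleR_one)
  then have "R = P" by simp
  with RS show ?thesis by (simp add: R_def S_def)
qed

lemma L_Q_left_eq_L_Q_right: "tp (tp y x y) x z = tp y (tp x y x) z"
  using jordan_identity[of y x y x z] by simp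

lemma Q_Q_eq: "tp y (tp x z x) y = 2 *\<^sub>R tp y x (tp y x z) - tp (tp y x y) x z"
proof -
  have "tp z x (tp y x y) = tp y x (tp y x z) - tp y (tp x z x) y + tp y x (tp y x z)"
    using jordan_identity[of z x y x y] tp_commute by metis
  then show ?thesis
    using tp_commute[of z x "tp y x y"] by (simp add: scaleR_2 algebra_simps)
qed

text \<open>This is \<open>Q(Q(x)y) = Q(x)Q(y)Q(x)\<close>. After one use of the Jordan identity,
  \<open>L_Q_commute\<close> moves everything inside \<open>Q(x)\<close>, where
  \<open>Q_Q_eq\<close> recognises \<open>Q(y)Q(x)z\<close>.\<close>

lemma fundamental_formula: "tp (tp x y x) z (tp x y x) = tp x (tp y (tp x z x) y) x"
proof -
  have S: "tp (tp x y x) z x = tp x (tp y x z) x"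
    using L_Q_commute[of x z y] tp_commute by metis
  have "tp (tp x y x) z (tp x y x)
      = tp (tp (tp x y x) z x) y x - tp x (tp z (tp x y x) y) x + tp x y (tp (tp x y x) z x)"
    using jordan_identity[of "tp x y x" z x y x] .
  also have "\<dots> = 2 *\<^sub>R tp x y (tp x (tp y x z) x) - tp x (tp z (tp x y x) y) x"
    unfolding S by (simp add: scaleR_2 tp_commute[of "tp x (tp y x z) x" y x])
  also have "\<dots> = tp x (2 *\<^sub>R tp y x (tp y x z) - tp y (tp x y x) z) x"
    by (simp add: tp_simps L_Q_commute tp_commute[of z _ y])
  also have "\<dots> = tp x (tp y (tp x z x) y) x"
    by (simp add: Q_Q_eq L_Q_left_eq_L_Q_right)
  finally show ?thesis .
qed

text \<open>Idempotents of the underlying Jordan pair; for these \<open>B(a,b)\<close> is the Peirce projection onto the kernel of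
  \<open>L(a,b)\<close>.\<close>

definition idem :: "'a \<Rightarrow> 'a \<Rightarrow> bool" where
  "idem a b \<longleftrightarrow> tp a b a = a \<and> tp b a b = b"

lemma idem_sym: "idem a b \<Longrightarrow> idem b a" by (simp add: idem_def)

lemma bergman_eq: "bergman_op tp a b z = z - 2 *\<^sub>R tp a b z + tp a (tp b z b) a"
  by (simp add: bergman_op_def L_op_def Q_op_def)

lemma linear_bergman: "linear (bergman_op tp a b)"
  by (rule linearI) (simp_all add: bergman_eq tp_simps algebra_simps)

lemma bergman_simps:
  "bergman_op tp a b (x + y) = bergman_op tp a b x + bergman_op tp a b y"
  "bergman_op tp a b (x - y) = bergman_op tp a b x - bergman_op tp a b y"
  "bergman_op tp a b (r *\<^sub>R x) = r *\<^sub>R bergman_op tp a b x"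
  "bergman_op tp a b 0 = 0"
  using linear_add linear_diff linear_scale linear_0 linear_bergman by blast+

section \<open>Peirce calculus of a fixed idempotent pair\<close>

context
  fixes a b assumes ab: "idem a b"
begin

lemma idem_eqs: "tp a b a = a" "tp b a b = b"
  using ab by (auto simp: idem_def)

lemma idem_Q_Q: "tp a (tp b z b) a = 2 *\<^sub>R tp a b (tp a b z) - tp a b z"
  using Q_Q_eq[of a b z] by (simp add: idem_eqs)

lemma idem_L_Q: "tp a b (tp a z a) = tp a z a"
proof -
  have "tp a b (tp a z a) = tp a z a - tp a b (tp a z a) + tp a z a"
    using jordan_identity[of a b a z a] by (simp add: idem_eqs L_Q_commute)
  then have "2 *\<^sub>R tp a b (tp a z a) = 2 *\<^sub>R tp a z a"
    by (simp add: scaleR_2 algebra_simps)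
  then show ?thesis by simp
qed

text \<open>With \<open>L = L(a,b)\<close> this is \<open>L(2L - 1)(L - 1) = 0\<close>: by
  \<open>idem_L_Q\<close>, \<open>L\<close> fixes the range of
  \<open>Q(a)Q(b) = 2L^2 - L\<close>.\<close>

lemma idem_cubic: "2 *\<^sub>R tp a b (tp a b (tp a b z)) = 3 *\<^sub>R tp a b (tp a b z) - tp a b z"
proof -
  have "tp a b (2 *\<^sub>R tp a b (tp a b z) - tp a b z) = 2 *\<^sub>R tp a b (tp a b z) - tp a b z"
    using idem_L_Q[of "tp b z b"] by (simp only: idem_Q_Q)
  then have "2 *\<^sub>R tp a b (tp a b (tp a b z)) = 2 *\<^sub>R tp a b (tp a b z) - tp a b z + tp a b (tp a b z)"
    by (simp add: tp_simps diff_eq_eq)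
  also have "\<dots> = (2 + 1) *\<^sub>R tp a b (tp a b z) - tp a b z"
    by (simp only: scaleR_add_left scaleR_one) simp
  finally show ?thesis by simp
qed

text \<open>The polynomial is \<open>(1 - L)(1 - 2L)\<close>, which is 1 at the eigenvalue 0 and
  vanishes at 1/2 and 1.\<close>

lemma idem_bergman: "bergman_op tp a b z = z - 3 *\<^sub>R tp a b z + 2 *\<^sub>R tp a b (tp a b z)"
proof -
  have "3 *\<^sub>R tp a b z = (2 + 1) *\<^sub>R tp a b z" by simp
  then have "3 *\<^sub>R tp a b z = 2 *\<^sub>R tp a b z + tp a b z"
    by (simp only: scaleR_add_left scaleR_one)
  then show ?thesis by (simp add: bergman_eq idem_Q_Q)
qed

lemma idem_L_bergman: "tp a b (bergman_op tp a b z) = 0"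
  by (simp add: idem_bergman tp_simps idem_cubic)

lemma idem_bergman_L: "bergman_op tp a b (tp a b z) = 0"
  by (simp add: idem_bergman tp_simps idem_cubic)

lemma idem_bergman_Q: "bergman_op tp a b (tp a z a) = 0"
  by (metis idem_L_Q idem_bergman_L)

lemma idem_bergman_id: "tp a b z = 0 \<Longrightarrow> bergman_op tp a b z = z"
  by (simp add: idem_bergman)

text \<open>First \<open>Q(b)z = Q(b)Q(a)Q(b)z = 0\<close>. Then one instance of the Jordan identity
  makes \<open>L(z,b)\<close> commute with \<open>L(a,b)\<close>, while another gives the commutator
  \<open>[L(a,b), L(z,b)] = - L(z,b)\<close>.\<close>

lemma peirce_zero_L:
  assumes z: "tp a b z = 0"
  shows "tp z b u = 0"
proof -
  have "tp b z b = tp b (tp a (tp b z b) a) b"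
    using fundamental_formula[of b a z] by (simp add: idem_eqs)
  then have Qbz: "tp b z b = 0" by (simp add: idem_Q_Q z)
  have "tp z b (tp a b u) = tp a b (tp z b u)"
    using jordan_identity[of z b a b u] z Qbz by (simp add: tp_commute[of z b a])
  then show ?thesis
    using jordan_identity[of a b z b u] z by (simp add: idem_eqs)
qed

lemma peirce_zero_two:
  assumes z: "tp a b z = 0"
  shows "tp a (tp b u b) z = 0"
  using jordan_identity[of u b a b z] z peirce_zero_L[OF z]
  by (simp add: tp_commute[of _ b z])

text \<open>Put \<open>F(y) = B(a,b){a,y,z}\<close> and \<open>D = L(b,a)\<close>. Since
  \<open>B(a,b)L(a,b) = 0\<close>, the Jordan identity gives \<open>F(y) = F(Dy)\<close>, so
  \<open>F(y) = F((2D^2 - D)y)\<close>. But \<open>2D^2 - D = Q(b)Q(a)\<close>, and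
  \<open>{a, Q(b)u, z} = 0\<close>.\<close>

lemma bergman_peirce_zero_L:
  assumes z: "tp a b z = 0"
  shows "bergman_op tp a b (tp a y z) = 0"
proof -
  have step: "bergman_op tp a b (tp a y z) = bergman_op tp a b (tp a (tp b a y) z)" for y
    using arg_cong[OF jordan_identity[of a b a y z], of "bergman_op tp a b"] z
    by (simp add: idem_eqs idem_bergman_L bergman_simps)
  have "tp b (tp a y a) b = 2 *\<^sub>R tp b a (tp b a y) - tp b a y"
    using Q_Q_eq[of b a y] by (simp add: idem_eqs)
  then have "0 = tp a (2 *\<^sub>R tp b a (tp b a y) - tp b a y) z"
    using peirce_zero_two[OF z, of "tp a y a"] by simp
  then have "0 = bergman_op tp a b (tp a (2 *\<^sub>R tp b a (tp b a y) - tp b a y) z)"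
    by (simp add: bergman_simps)
  then show ?thesis
    by (simp add: bergman_simps tp_simps scaleR_2 flip: step)
qed

text \<open>In \<open>B(a,y)z = z - 2{a,y,z} + Q(a)Q(y)z\<close> the projection
  \<open>B(a,b)\<close> fixes the first term and kills the other two.\<close>

lemma bergman_peirce_zero:
  assumes z: "tp a b z = 0"
  shows "bergman_op tp a b (bergman_op tp a y z) = z"
  by (simp add: bergman_eq[of a y] bergman_simps idem_bergman_id z bergman_peirce_zero_L idem_bergman_Q)

lemma bergman_compress:
  "bergman_op tp a b (bergman_op tp a y (bergman_op tp a b z)) = bergman_op tp a b z"
  by (rule bergman_peirce_zero) (rule idem_L_bergman)

end

text \<open>For \<open>v\<close> in the kernel of \<open>L(b,a)\<close> one has \<open>L(b,a)Q(v) = - Q(v)L(a,b)\<close>. The spectrum of \<open>L(a,b)\<close> lies in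
  \<open>{1/2, 1}\<close> and that of \<open>L(b,a)\<close> in \<open>{0, 1/2, 1}\<close>, so \<open>Q(v) = 0\<close> and \<open>v = 0\<close>.\<close>

lemma idem_bergman_swap:
  assumes ab: "idem a b" and 0: "bergman_op tp a b = (\<lambda>z. 0)"
  shows "bergman_op tp b a = (\<lambda>z. 0)"
proof
  fix u
  define v where "v = bergman_op tp b a u"
  have v: "tp b a v = 0" unfolding v_def by (rule idem_L_bergman[OF idem_sym[OF ab]])
  define q q1 q2 where "q = tp v v v" and "q1 = tp b a q" and "q2 = tp b a q1"
  have LQ: "tp b a (tp v z v) = - tp v (tp a b z) v" for z
    using jordan_identity[of b a v z v] v by simp
  have "v - 3 *\<^sub>R tp a b v + 2 *\<^sub>R tp a b (tp a b v) = 0"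
    using 0 by (simp flip: idem_bergman[OF ab])
  then have "tp v (v - 3 *\<^sub>R tp a b v + 2 *\<^sub>R tp a b (tp a b v)) v = 0" by simp
  \<comment> \<open>By \<open>LQ\<close> each factor \<open>L(a,b)\<close> inside
    \<open>Q(v)\<close> comes out as \<open>- L(b,a)\<close>, which turns the signs of the
    polynomial positive.\<close>
  then have q: "q + 3 *\<^sub>R q1 + 2 *\<^sub>R q2 = 0"
    by (simp add: q1_def q2_def q_def LQ tp_simps)
  then have "tp b a (q + 3 *\<^sub>R q1 + 2 *\<^sub>R q2) = 0" by simp
  moreover have "2 *\<^sub>R tp b a q2 = 3 *\<^sub>R q2 - q1"
    unfolding q2_def q1_def by (rule idem_cubic[OF idem_sym[OF ab]])
  ultimately have "3 *\<^sub>R q2 + 3 *\<^sub>R q2 = 0"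
    by (simp add: tp_simps flip: q1_def q2_def)
  then have "(3 + 3) *\<^sub>R q2 = 0" by (simp only: scaleR_add_left)
  then have q2: "q2 = 0" by simp
  with q have "q = - (3 *\<^sub>R q1)" by (simp add: eq_neg_iff_add_eq_0)
  then have "q1 = tp b a (- (3 *\<^sub>R q1))" using q1_def by metis
  then have "q1 = 0" using q2 by (simp add: tp_simps flip: q2_def)
  with \<open>q = - (3 *\<^sub>R q1)\<close> have "tp v v v = 0" by (simp add: q_def)
  then have "norm v ^ 3 = 0" by (metis norm_cube norm_zero)
  then show "bergman_op tp b a u = 0" by (simp add: v_def)
qed

section \<open>Inner inverses of BP quasi-invertible elements\<close>

lemma bergman_zero_Q:
  assumes "bergman_op tp x y = (\<lambda>z. 0)"
  shows "tp x (2 *\<^sub>R y - tp y x y) x = x"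
proof -
  have "x - 2 *\<^sub>R tp x y x + tp x (tp y x y) x = 0"
    using fun_cong[OF assms, of x] by (simp add: bergman_eq)
  then show ?thesis by (simp add: tp_simps algebra_simps)
qed

lemma idem_of_Q:
  assumes "tp x w x = x"
  shows "idem x (tp w x w)"
proof -
  have "tp x (tp w x w) x = x"
    using fundamental_formula[of x w w] assms by simp
  then show ?thesis
    using fundamental_formula[of w x x] by (simp add: idem_def)
qed

text \<open>The partner \<open>y\<close> of a BP quasi-invertible element carries no norm bound. It
  can be replaced by one built from any inner inverse \<open>w\<close>, whose norm the conorm
  controls.\<close>

lemma bergman_zero_of_Q:
  assumes "bergman_op tp x y = (\<lambda>z. 0)" "tp x w x = x"
  shows "bergman_op tp x (tp w x w) = (\<lambda>z. 0)"
  using bergman_compress[OF idem_of_Q[OF assms(2)], of y] by (simp add: assms(1) bergman_simps fun_eq_iff)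

end

section \<open>Semicontinuity of the quadratic conorm\<close>

context jb_triple
begin

lemma bounded_linear_Q: "bounded_linear (Q_op tp a)"
  unfolding Q_op_def by (rule bounded_linear_tp_mid)

lemma linear_Q: "linear (Q_op tp a)"
  by (rule bounded_linear.linear[OF bounded_linear_Q])

lemma le_quadratic_conorm_iff:
  "c \<ge> 0 \<Longrightarrow> ereal c \<le> quadratic_conorm tp a \<longleftrightarrow> lower_bound_mod (Q_op tp a) c"
  unfolding quadratic_conorm_def by (rule le_reduced_min_modulus_iff[OF linear_Q])

lemma quadratic_conorm_nonneg: "quadratic_conorm tp a \<ge> 0"
  unfolding quadratic_conorm_def by (rule reduced_min_modulus_nonneg)

text \<open>\<open>Q(x)Q(y)Q(x) = Q(Q(x)y) = Q(x)\<close>, so \<open>u - Q(y)Q(x)u\<close> lies in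
  the kernel of \<open>Q(x)\<close>, and \<open>K\<close> bounds the norm of
  \<open>Q(y)\<close>.\<close>

lemma lower_bound_mod_Q:
  assumes "tp x y x = x" "16 * norm y ^ 2 \<le> K" "K > 0"
  shows "lower_bound_mod (Q_op tp x) (1 / K)"
proof (rule lower_bound_modI)
  fix u and \<epsilon> :: real assume "\<epsilon> > 0"
  let ?v = "tp y (tp x u x) y"
  have "Q_op tp x (u - ?v) = 0"
    using fundamental_formula[of x y u] assms by (simp add: Q_op_def tp_simps)
  moreover have "norm ?v \<le> K * norm (tp x u x)"
  proof -
    have "norm ?v \<le> 16 * norm y ^ 2 * norm (tp x u x)"
      using norm_tp_le[of y "tp x u x" y] by (simp add: power2_eq_square mult_ac)
    also have "\<dots> \<le> K * norm (tp x u x)" by (intro mult_right_mono assms) simp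
    finally show ?thesis .
  qed
  then have "norm ?v / K \<le> norm (tp x u x)" using \<open>K > 0\<close> by (simp add: field_simps)
  then have "1 / K * norm (u - (u - ?v)) \<le> norm (Q_op tp x u) + \<epsilon>"
    using \<open>\<epsilon> > 0\<close> by (simp add: Q_op_def)
  ultimately show "\<exists>k. Q_op tp x k = 0 \<and> 1 / K * norm (u - k) \<le> norm (Q_op tp x u) + \<epsilon>" by blast
qed (use assms in auto)

lemma norm_Q_diff_le:
  "norm (tp x v x - tp a v a) \<le> 16 * norm (x - a) * (norm x + norm a) * norm v"
proof -
  have "tp x v x - tp a v a = tp (x - a) v x + tp (x - a) v a"
    using tp_commute[of x v a] by (simp add: tp_simps)
  also have "norm \<dots> \<le> 16 * norm (x - a) * norm v * norm x + 16 * norm (x - a) * norm v * norm a"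
    by (intro norm_triangle_mono norm_tp_le)
  finally show ?thesis by (simp add: algebra_simps)
qed

lemma quadratic_conorm_limit:
  assumes "c > 0" and near: "\<And>e. e > 0 \<Longrightarrow> \<exists>x. norm (x - a) < e \<and> ereal c \<le> quadratic_conorm tp x"
  shows "ereal c \<le> quadratic_conorm tp a"
proof -
  have "lower_bound_mod (Q_op tp a) c"
  proof (rule lower_bound_mod_limit[OF bounded_linear_Q \<open>c > 0\<close>])
    fix \<eta> :: real assume "\<eta> > 0"
    \<comment> \<open>\<open>D\<close> is a Lipschitz constant at \<open>a\<close> for
      \<open>Q\<close> on the unit ball about \<open>a\<close>; the radius \<open>e\<close> brings
      \<open>Q(x)\<close> within \<open>\<eta>\<close> of \<open>Q(a)\<close>.\<close>
    define D where "D = 16 * (2 * norm a + 1)"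
    have "D > 0" by (simp add: D_def add_nonneg_pos)
    define e where "e = min 1 (\<eta> / D)"
    have "e > 0" using \<open>\<eta> > 0\<close> \<open>D > 0\<close> by (simp add: e_def)
    then obtain x where x: "norm (x - a) < e" "ereal c \<le> quadratic_conorm tp x" using near by blast
    have "norm x \<le> norm a + 1" using x(1) norm_triangle_sub[of x a] by (simp add: e_def)
    then have "16 * norm (x - a) * (norm x + norm a) \<le> 16 * e * (2 * norm a + 1)"
      using x(1) \<open>e > 0\<close> by (intro mult_mono) auto
    also have "\<dots> = e * D" by (simp add: D_def)
    also have "\<dots> \<le> \<eta>" using \<open>D > 0\<close> by (simp add: e_def min_mult_distrib_right)
    finally have le: "16 * norm (x - a) * (norm x + norm a) \<le> \<eta>" .
    have "norm (Q_op tp x v - Q_op tp a v) \<le> \<eta> * norm v" for v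
      using order_trans[OF norm_Q_diff_le mult_right_mono[OF le]] by (simp add: Q_op_def)
    with x(2) \<open>c > 0\<close> show "\<exists>S. linear S \<and> lower_bound_mod S c \<and> (\<forall>v. norm (S v - Q_op tp a v) \<le> \<eta> * norm v)"
      by (intro exI[of _ "Q_op tp x"]) (auto simp: linear_Q le_quadratic_conorm_iff)
  qed
  with \<open>c > 0\<close> show ?thesis by (simp add: le_quadratic_conorm_iff)
qed

lemma quadratic_conorm_upper_semicontinuous:
  assumes "quadratic_conorm tp a < c"
  shows "eventually (\<lambda>x. quadratic_conorm tp x < c) (nhds a)"
proof (rule ccontr)
  assume not_ev: "\<not> ?thesis"
  obtain r where r: "quadratic_conorm tp a < ereal r" "ereal r < c"
    using ereal_dense2[OF assms] by blast
  have "r > 0" using r(1) quadratic_conorm_nonneg[of a] by (metis ereal_less(2) le_less_trans)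
  have "\<exists>x. norm (x - a) < e \<and> ereal r \<le> quadratic_conorm tp x" if "e > 0" for e
    using not_ev r(2) that unfolding eventually_nhds_metric dist_norm
    by (meson less_imp_le not_less order.trans)
  from quadratic_conorm_limit[OF \<open>r > 0\<close> this] r(1) show False by simp
qed

section \<open>Stability near BP quasi-invertible elements\<close>

lemma norm_bergman_diff_left_le:
  "norm (bergman_op tp x b z - bergman_op tp a b z)
     \<le> (32 * norm b + 256 * norm b ^ 2 * (norm x + norm a)) * norm (x - a) * norm z"
proof -
  let ?q = "tp b z b"
  have "bergman_op tp x b z - bergman_op tp a b z = (tp x ?q x - tp a ?q a) - 2 *\<^sub>R tp (x - a) b z"
    by (simp add: bergman_eq tp_simps algebra_simps)
  also have "norm \<dots> \<le> norm (tp x ?q x - tp a ?q a) + 2 * norm (tp (x - a) b z)"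
    by (rule order_trans[OF norm_triangle_ineq4]) simp
  also have "\<dots> \<le> 16 * norm (x - a) * (norm x + norm a) * (16 * norm b * norm z * norm b)
      + 2 * (16 * norm (x - a) * norm b * norm z)"
    by (intro add_mono order_trans[OF norm_Q_diff_le] mult_left_mono norm_tp_le) auto
  finally show ?thesis by (simp add: algebra_simps power2_eq_square)
qed

lemma norm_bergman_diff_right_le:
  "norm (bergman_op tp b x z - bergman_op tp b a z)
     \<le> (32 * norm b + 256 * norm b ^ 2 * (norm x + norm a)) * norm (x - a) * norm z"
proof -
  let ?q = "tp x z x - tp a z a"
  have "bergman_op tp b x z - bergman_op tp b a z = tp b ?q b - 2 *\<^sub>R tp b (x - a) z"
    by (simp add: bergman_eq tp_simps algebra_simps)
  also have "norm \<dots> \<le> norm (tp b ?q b) + 2 * norm (tp b (x - a) z)"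
    by (rule order_trans[OF norm_triangle_ineq4]) simp
  also have "\<dots> \<le> 16 * norm b * (16 * norm (x - a) * (norm x + norm a) * norm z) * norm b
      + 2 * (16 * norm b * norm (x - a) * norm z)"
    by (intro add_mono order_trans[OF norm_tp_le] mult_left_mono mult_right_mono norm_Q_diff_le norm_tp_le) auto
  finally show ?thesis by (simp add: algebra_simps power2_eq_square)
qed

lemma Q_bergman_commute: "tp x (bergman_op tp b x y) x = bergman_op tp x b (tp x y x)"
  by (simp add: bergman_eq tp_simps L_Q_commute)

text \<open>\<open>y\<close> is the fixed point of \<open>y = w + B(b,x)y\<close> with \<open>w = 2b - Q(b)x\<close>. Since \<open>Q(x)B(b,x) = B(x,b)Q(x)\<close> and
  \<open>Q(x)w = x - B(x,b)x\<close>, the defect \<open>Q(x)y - x\<close> is fixed by \<open>B(x,b)\<close>.\<close>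

lemma Q_solvable_of_small_bergman:
  assumes xb: "\<And>z. norm (bergman_op tp x b z) \<le> norm z / 2"
    and bx: "\<And>z. norm (bergman_op tp b x z) \<le> norm z / 2"
  shows "\<exists>y. tp x y x = x \<and> norm y \<le> 2 * norm (2 *\<^sub>R b - tp b x b)"
proof -
  define w where "w = 2 *\<^sub>R b - tp b x b"
  have "\<exists>!y. w + bergman_op tp b x y = y"
  proof (rule banach_fix_type[of "1/2"])
    show "\<forall>y z. dist (w + bergman_op tp b x y) (w + bergman_op tp b x z) \<le> 1 / 2 * dist y z"
      using bx by (simp add: dist_norm flip: bergman_simps)
  qed auto
  then obtain y where y: "w + bergman_op tp b x y = y" by blast
  have "norm y \<le> norm w + norm y / 2"
    using norm_triangle_ineq[of w "bergman_op tp b x y"] bx[of y] y by simp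
  moreover have "tp x y x = x"
  proof -
    have "tp x y x = tp x (w + bergman_op tp b x y) x" by (simp add: y)
    also have "\<dots> = tp x w x + bergman_op tp x b (tp x y x)" by (simp add: tp_simps Q_bergman_commute)
    also have "tp x w x = x - bergman_op tp x b x"
      by (simp add: bergman_eq w_def tp_simps)
    finally have "tp x y x - x = bergman_op tp x b (tp x y x - x)"
      by (simp add: bergman_simps algebra_simps)
    then have "norm (tp x y x - x) \<le> norm (tp x y x - x) / 2" by (metis xb)
    then show ?thesis by simp
  qed
  ultimately show ?thesis by (intro exI[of _ y]) (simp add: w_def)
qed

lemma bp_quasi_invertible_lower_bound:
  assumes "a \<in> bp_quasi_invertibles tp"
  shows "\<exists>\<delta>>0. eventually (\<lambda>x. lower_bound_mod (Q_op tp x) \<delta>) (nhds a)"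
proof -
  obtain y where y: "bergman_op tp a y = (\<lambda>z. 0)"
    using assms by (auto simp: bp_quasi_invertibles_def)
  \<comment> \<open>The partner \<open>y\<close> is exchanged for a \<open>b\<close> that forms an
    idempotent pair with \<open>a\<close>, because \<open>idem_bergman_swap\<close> then supplies
    \<open>B(b,a) = 0\<close> as well.\<close>
  define w where "w = 2 *\<^sub>R y - tp y a y"
  define b where "b = tp w a w"
  have w: "tp a w a = a" unfolding w_def by (rule bergman_zero_Q[OF y])
  have B: "bergman_op tp a b = (\<lambda>z. 0)" unfolding b_def by (rule bergman_zero_of_Q[OF y w])
  have B': "bergman_op tp b a = (\<lambda>z. 0)"
    using idem_bergman_swap[OF idem_of_Q[OF w]] B by (simp add: b_def)
  \<comment> \<open>On the unit ball about \<open>a\<close>, \<open>C\<close> is a Lipschitz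
    constant at \<open>a\<close> of both \<open>B(x,b)\<close> and \<open>B(b,x)\<close> as
    functions of \<open>x\<close>, \<open>R\<close> bounds the solution of \<open>Q(x)y = x\<close>,
    and \<open>K\<close> bounds the norm of \<open>Q(y)\<close>.\<close>
  define C where "C = 32 * norm b + 256 * norm b ^ 2 * (2 * norm a + 1)"
  define R where "R = 2 * (2 * norm b + 16 * norm b ^ 2 * (norm a + 1))"
  define K where "K = 16 * R ^ 2 + 1"
  have "C \<ge> 0" by (simp add: C_def)
  have "lower_bound_mod (Q_op tp x) (1 / K)" if x: "norm (x - a) < min 1 (1 / (2 * (C + 1)))" for x
  proof -
    have nx: "norm x \<le> norm a + 1" using x norm_triangle_sub[of x a] by simp
    have "(C + 1) * norm (x - a) \<le> 1 / 2"
      using x \<open>C \<ge> 0\<close> by (simp add: field_simps)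
    then have "C * norm (x - a) + norm (x - a) \<le> 1 / 2" by (simp only: distrib_right mult_1_left)
    then have "C * norm (x - a) \<le> 1 / 2" using norm_ge_zero[of "x - a"] by linarith
    moreover have "32 * norm b + 256 * norm b ^ 2 * (norm x + norm a) \<le> C"
      unfolding C_def using nx by (intro add_left_mono mult_left_mono) auto
    ultimately have "(32 * norm b + 256 * norm b ^ 2 * (norm x + norm a)) * norm (x - a) \<le> 1 / 2"
      by (meson mult_right_mono norm_ge_zero order_trans)
    from mult_right_mono[OF this norm_ge_zero]
    have small: "(32 * norm b + 256 * norm b ^ 2 * (norm x + norm a)) * norm (x - a) * norm z \<le> norm z / 2" for z :: 'a
      by simp
    have "norm (bergman_op tp x b z) \<le> norm z / 2" "norm (bergman_op tp b x z) \<le> norm z / 2" for z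
      using order_trans[OF norm_bergman_diff_left_le small[of z]]
        order_trans[OF norm_bergman_diff_right_le small[of z]] by (simp_all add: B B')
    then obtain y where y: "tp x y x = x" "norm y \<le> 2 * norm (2 *\<^sub>R b - tp b x b)"
      using Q_solvable_of_small_bergman by blast
    have "norm (2 *\<^sub>R b - tp b x b) \<le> 2 * norm b + 16 * norm b * norm x * norm b"
      using norm_triangle_ineq4[of "2 *\<^sub>R b" "tp b x b"] norm_tp_le[of b x b] by simp
    also have "\<dots> = 2 * norm b + 16 * norm b ^ 2 * norm x" by (simp add: power2_eq_square)
    also have "\<dots> \<le> R / 2" unfolding R_def using nx by (simp add: mult_left_mono)
    finally have "norm y \<le> R" using y(2) by simp
    then have "norm y ^ 2 \<le> R ^ 2" by (intro power_mono) auto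
    then show ?thesis
      by (intro lower_bound_mod_Q[OF y(1)]) (auto simp: K_def intro: add_nonneg_pos)
  qed
  then have "eventually (\<lambda>x. lower_bound_mod (Q_op tp x) (1 / K)) (nhds a)"
    unfolding eventually_nhds_metric dist_norm using \<open>C \<ge> 0\<close>
    by (intro exI[of _ "min 1 (1 / (2 * (C + 1)))"]) auto
  moreover have "1 / K > 0" by (auto simp: K_def intro!: divide_pos_pos add_nonneg_pos)
  ultimately show ?thesis by blast
qed

lemma bp_quasi_invertible_lower_semicontinuous:
  assumes "a \<in> bp_quasi_invertibles tp" and c: "c < quadratic_conorm tp a"
  shows "eventually (\<lambda>x. c < quadratic_conorm tp x) (nhds a)"
proof (cases "c < 0")
  case True
  then show ?thesis using quadratic_conorm_nonneg by (intro always_eventually allI) (rule less_le_trans)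
next
  case False
  obtain r where r: "c < ereal r" "ereal r < quadratic_conorm tp a"
    using ereal_dense2[OF c] by blast
  \<comment> \<open>The gap between \<open>r\<close> and \<open>r'\<close> absorbs the loss in
    \<open>lower_bound_mod_perturb\<close>, whose uniform bound \<open>\<delta>\<close> comes from
    BP quasi-invertibility.\<close>
  obtain r' where r': "ereal r < ereal r'" "ereal r' < quadratic_conorm tp a"
    using ereal_dense2[OF r(2)] by blast
  have "0 < ereal r" using r(1) False by (meson le_less_trans not_less)
  then have r_pos: "0 < r" "r < r'" using r' by auto
  have lb: "lower_bound_mod (Q_op tp a) r'"
    using r'(2) r_pos by (subst le_quadratic_conorm_iff[symmetric]) auto
  obtain \<delta> where \<delta>: "\<delta> > 0" "eventually (\<lambda>x. lower_bound_mod (Q_op tp x) \<delta>) (nhds a)"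
    using bp_quasi_invertible_lower_bound[OF assms(1)] by blast
  obtain \<eta> where \<eta>: "\<eta> > 0" "\<And>S T :: 'a \<Rightarrow> 'a. linear S \<Longrightarrow> linear T \<Longrightarrow> lower_bound_mod T r' \<Longrightarrow> lower_bound_mod S \<delta> \<Longrightarrow>
    (\<And>v. norm (S v - T v) \<le> \<eta> * norm v) \<Longrightarrow> lower_bound_mod S r"
    using lower_bound_mod_perturb[OF r_pos \<delta>(1), where 'a = 'a and 'b = 'a] by metis
  have "((\<lambda>x. 16 * norm (x - a) * (norm x + norm a)) \<longlongrightarrow> 16 * norm (a - a) * (norm a + norm a)) (nhds a)"
    by (intro tendsto_intros filterlim_ident)
  then have "((\<lambda>x. 16 * norm (x - a) * (norm x + norm a)) \<longlongrightarrow> 0) (nhds a)" by simp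
  then have "eventually (\<lambda>x. 16 * norm (x - a) * (norm x + norm a) < \<eta>) (nhds a)"
    using \<eta>(1) by (rule order_tendstoD)
  with \<delta>(2) show ?thesis
  proof eventually_elim
    case (elim x)
    have "norm (Q_op tp x v - Q_op tp a v) \<le> \<eta> * norm v" for v
      using order_trans[OF norm_Q_diff_le mult_right_mono[OF less_imp_le[OF elim(2)]]] by (simp add: Q_op_def)
    from \<eta>(2)[OF linear_Q linear_Q lb elim(1) this]
    have "ereal r \<le> quadratic_conorm tp x" using r_pos by (simp add: le_quadratic_conorm_iff)
    with r(1) show ?case by simp
  qed
qed

lemma isCont_quadratic_conorm_of_bp:
  assumes "a \<in> bp_quasi_invertibles tp"
  shows "isCont (quadratic_conorm tp) a"
  unfolding continuous_at
  by (rule order_tendstoI)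
    (use quadratic_conorm_upper_semicontinuous bp_quasi_invertible_lower_semicontinuous[OF assms]
      in \<open>auto intro: filter_leD[OF at_le] simp: eventually_nhds_conv_at\<close>)

lemma isCont_quadratic_conorm_of_zero:
  assumes "quadratic_conorm tp a = 0"
  shows "isCont (quadratic_conorm tp) a"
  unfolding continuous_at
proof (rule order_tendstoI)
  fix c assume "c < quadratic_conorm tp a"
  then have "c < quadratic_conorm tp x" for x
    using assms quadratic_conorm_nonneg by (metis less_le_trans)
  then show "eventually (\<lambda>x. c < quadratic_conorm tp x) (at a)" by simp
next
  fix c assume "quadratic_conorm tp a < c"
  from quadratic_conorm_upper_semicontinuous[OF this]
  show "eventually (\<lambda>x. quadratic_conorm tp x < c) (at a)" by (simp add: eventually_nhds_conv_at)
qed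

section \<open>Continuity at a regular point forces BP quasi-invertibility\<close>

lemma bp_quasi_invertible_of_isCont:
  assumes rich: "extremally_rich tp" and reg: "tp a b a = a" "tp b a b = b"
    and cont: "isCont (quadratic_conorm tp) a"
  shows "a \<in> bp_quasi_invertibles tp"
proof -
  have ab: "idem a b" by (simp add: idem_def reg)
  define K where "K = 16 * norm b ^ 2 + 1"
  have "K > 0" by (simp add: K_def add_nonneg_pos)
  define c where "c = 1 / (2 * K)"
  have "c > 0" using \<open>K > 0\<close> by (simp add: c_def)
  have "ereal (1 / K) \<le> quadratic_conorm tp a"
    using lower_bound_mod_Q[OF reg(1) _ \<open>K > 0\<close>] \<open>K > 0\<close> by (simp add: K_def le_quadratic_conorm_iff)
  moreover have "ereal c < ereal (1 / K)" using \<open>K > 0\<close> by (simp add: c_def field_simps)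
  ultimately have "ereal c < quadratic_conorm tp a" by (rule less_le_trans[rotated])
  then have "eventually (\<lambda>x. ereal c < quadratic_conorm tp x) (nhds a)"
    using cont by (auto simp: continuous_at eventually_nhds_conv_at dest: order_tendstoD)
  then obtain e where "e > 0" and e: "\<And>x. norm (x - a) < e \<Longrightarrow> ereal c < quadratic_conorm tp x"
    by (auto simp: eventually_nhds_metric dist_norm)
  \<comment> \<open>\<open>N\<close> bounds \<open>x\<close> near \<open>a\<close>,
    \<open>2 * N / c\<close> will bound an inner inverse \<open>w\<close> of \<open>x\<close>,
    \<open>R\<close> the partner \<open>tp w x w\<close>, and \<open>C\<close> the Lipschitz
    constant of the Bergman operator with that partner.\<close>
  define N where "N = norm a + 1"
  define R where "R = 16 * (2 * N / c) ^ 2 * N"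
  define C where "C = 32 * R + 256 * R ^ 2 * (2 * N)"
  have "N > 0" by (simp add: N_def add_nonneg_pos)
  have "R \<ge> 0" "C \<ge> 0" using \<open>N > 0\<close> by (auto simp: R_def C_def)
  obtain M where M: "M > 0" "\<And>z. norm (bergman_op tp a b z) \<le> norm z * M"
  proof -
    have "bounded_linear (bergman_op tp a b)"
      unfolding bergman_eq
      by (intro bounded_linear_intros bounded_linear_compose[OF bounded_linear_tp_right]
          bounded_linear_tp_right bounded_linear_compose[OF bounded_linear_tp_mid] bounded_linear_tp_mid
          bounded_linear_add bounded_linear_sub bounded_linear_ident bounded_linear_scaleR_right)
    then show thesis using that bounded_linear.pos_bounded by blast
  qed
  define \<eta> where "\<eta> = min (min e 1) (1 / (2 * M * (C + 1)))"
  have "\<eta> > 0" using \<open>e > 0\<close> M \<open>C \<ge> 0\<close> by (simp add: \<eta>_def)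
  have "a \<in> closure (bp_quasi_invertibles tp)" using rich by (simp add: extremally_rich_def)
  then obtain x where x: "x \<in> bp_quasi_invertibles tp" "norm (x - a) < \<eta>"
    using \<open>\<eta> > 0\<close> by (auto simp: closure_approachable dist_norm)
  obtain y where y: "bergman_op tp x y = (\<lambda>z. 0)"
    using x(1) by (auto simp: bp_quasi_invertibles_def)
  have nx: "norm x \<le> N" using x(2) norm_triangle_sub[of x a] by (simp add: N_def \<eta>_def)
  have "lower_bound_mod (Q_op tp x) c"
    using e[of x] x(2) \<open>c > 0\<close> by (subst le_quadratic_conorm_iff[symmetric]) (auto simp: \<eta>_def)
  \<comment> \<open>\<open>Q(x)\<close> sends this vector to \<open>x\<close>, of norm less than
    \<open>2 * N\<close>; the lower bound \<open>c\<close> therefore allows a kernel vector to be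
    subtracted that leaves norm below \<open>2 * N / c\<close>.\<close>
  moreover have "norm (Q_op tp x (2 *\<^sub>R y - tp y x y)) < c * (2 * N / c)"
    using nx \<open>N > 0\<close> \<open>c > 0\<close> by (simp add: Q_op_def bergman_zero_Q[OF y])
  ultimately obtain k where k: "Q_op tp x k = 0" "norm (2 *\<^sub>R y - tp y x y - k) < 2 * N / c"
    using lower_bound_modD[OF _ linear_Q \<open>c > 0\<close>] by blast
  define w where "w = 2 *\<^sub>R y - tp y x y - k"
  have w: "tp x w x = x"
    using k(1) bergman_zero_Q[OF y] by (simp add: w_def Q_op_def tp_diff_mid)
  define y' where "y' = tp w x w"
  have y': "bergman_op tp x y' = (\<lambda>z. 0)" unfolding y'_def by (rule bergman_zero_of_Q[OF y w])
  have "norm y' \<le> 16 * (norm w) ^ 2 * norm x"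
    using norm_tp_le[of w x w] by (simp add: y'_def power2_eq_square mult_ac)
  also have "\<dots> \<le> R"
    unfolding R_def using k(2) nx by (intro mult_mono power_mono) (auto simp: w_def)
  finally have "norm y' \<le> R" .
  have C: "norm (bergman_op tp a y' z) \<le> C * norm (x - a) * norm z" for z
  proof -
    have "norm (bergman_op tp a y' z) \<le> (32 * norm y' + 256 * norm y' ^ 2 * (norm x + norm a)) * norm (x - a) * norm z"
      using norm_bergman_diff_left_le[of x y' z a] by (simp add: y')
    also have "\<dots> \<le> C * norm (x - a) * norm z"
      unfolding C_def using \<open>norm y' \<le> R\<close> nx
      by (intro mult_right_mono add_mono mult_mono power_mono) (auto simp: N_def)
    finally show ?thesis .
  qed
  have "bergman_op tp a b z = 0" for z
  proof -
    let ?p = "bergman_op tp a b z"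
    \<comment> \<open>Compression recovers \<open>?p\<close> from \<open>B(a,y') ?p\<close>, which
      is small; the resulting factor 1/2 leaves only \<open>?p = 0\<close>.\<close>
    have "norm ?p = norm (bergman_op tp a b (bergman_op tp a y' ?p))"
      by (simp add: bergman_compress[OF ab])
    also have "\<dots> \<le> norm (bergman_op tp a y' ?p) * M" by (rule M)
    also have "\<dots> \<le> (C * norm (x - a) * norm ?p) * M" using M C by (intro mult_right_mono) auto
    also have "\<dots> = (M * C * norm (x - a)) * norm ?p" by simp
    also have "\<dots> \<le> (1/2) * norm ?p"
    proof (rule mult_right_mono)
      have "norm (x - a) \<le> 1 / (2 * M * (C + 1))" using x(2) by (simp add: \<eta>_def)
      moreover have "0 < 2 * M * (C + 1)" using M \<open>C \<ge> 0\<close> by simp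
      ultimately have "norm (x - a) * (2 * M * (C + 1)) \<le> 1"
        using pos_le_divide_eq by blast
      then have "M * C * norm (x - a) + M * norm (x - a) \<le> 1 / 2" by (simp add: algebra_simps)
      moreover have "M * norm (x - a) \<ge> 0" using M by simp
      ultimately show "M * C * norm (x - a) \<le> 1 / 2" by linarith
    qed auto
    finally show ?thesis by simp
  qed
  then show ?thesis unfolding bp_quasi_invertibles_def by blast
qed

end

section \<open>The span of the odd powers of an element\<close>

lemma (in vector_space) funpow_scale_linear:
  assumes "Vector_Spaces.linear scale scale T"
  shows "((\<lambda>y. scale c (T y)) ^^ n) x = scale (c ^ n) ((T ^^ n) x)"
  by (induction n) (use assms in \<open>auto simp: Vector_Spaces.linear_iff\<close>)

lemma subspace_closure:
  fixes S :: "'a::real_normed_vector set"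
  assumes "subspace S"
  shows "subspace (closure S)"
  unfolding subspace_def
proof (intro conjI ballI allI)
  show "0 \<in> closure S" using subspace_0[OF assms] closure_subset by blast
  show "x + y \<in> closure S" if xy: "x \<in> closure S" "y \<in> closure S" for x y
  proof -
    obtain f where "\<forall>n. f n \<in> S" "f \<longlonglongrightarrow> x"
      using xy(1) unfolding closure_sequential by blast
    moreover obtain g where "\<forall>n. g n \<in> S" "g \<longlonglongrightarrow> y"
      using xy(2) unfolding closure_sequential by blast
    ultimately show ?thesis unfolding closure_sequential
      by (intro exI[of _ "\<lambda>n. f n + g n"]) (auto intro: tendsto_add subspace_add[OF assms])
  qed
  show "c *\<^sub>R x \<in> closure S" if x: "x \<in> closure S" for c x
  proof -
    obtain f where "\<forall>n. f n \<in> S" "f \<longlonglongrightarrow> x"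
      using x unfolding closure_sequential by blast
    then show ?thesis unfolding closure_sequential
      by (intro exI[of _ "\<lambda>n. c *\<^sub>R f n"]) (auto intro: tendsto_scaleR subspace_scale[OF assms])
  qed
qed

context jb_triple
begin

text \<open>Index \<open>k\<close> stands for the power of exponent \<open>2k + 1\<close>.\<close>

definition odd_power :: "'a \<Rightarrow> nat \<Rightarrow> 'a" where
  "odd_power a k = ((tp a a) ^^ k) a"

lemma odd_power_simps [simp]: "odd_power a 0 = a" "odd_power a (Suc k) = tp a a (odd_power a k)"
  by (simp_all add: odd_power_def)

lemma L_commutator:
  "tp x y (tp u v w) - tp u v (tp x y w) = tp (tp x y u) v w - tp u (tp y x v) w"
  using jordan_identity[of x y u v w] by simp

text \<open>Consecutive operators \<open>L(a\<^sub>i, a\<^sub>j)\<close> with \<open>i + j = n + 1\<close> differ by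
  \<open>D = [L(a,a), L(a\<^sub>n,a)]\<close>, so the outermost two differ by \<open>(n + 1) D\<close>. But their difference is also
  \<open>[L(a\<^sub>n,a), L(a,a)] = - D\<close>; hence \<open>D = 0\<close>.\<close>

lemma L_odd_power:
  "i + j = n \<Longrightarrow> tp (odd_power a i) (odd_power a j) z = tp (odd_power a n) a z"
  "tp a (odd_power a n) z = tp (odd_power a n) a z"
  "tp a a (tp (odd_power a n) a z) = tp (odd_power a n) a (tp a a z)"
proof -
  let ?p = "odd_power a"
  define W where "W n \<longleftrightarrow> (\<forall>i j z. i + j = n \<longrightarrow> tp (?p i) (?p j) z = tp (?p n) a z)" for n
  have step: "tp a a (tp (?p n) a z) = tp (?p n) a (tp a a z) \<and>
      (\<forall>i\<le>Suc n. tp (?p i) (?p (Suc n - i)) z = tp (?p 0) (?p (Suc n)) z)" if W: "W n" for n z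
  proof -
    define D where "D = tp a a (tp (?p n) a z) - tp (?p n) a (tp a a z)"
    define l where "l i = tp (?p i) (?p (Suc n - i)) z" for i
    have "l (Suc i) - l i = D" if "i \<le> n" for i
    proof -
      have "D = tp a a (tp (?p i) (?p (n - i)) z) - tp (?p i) (?p (n - i)) (tp a a z)"
        using W that unfolding W_def D_def by (metis le_add_diff_inverse)
      also have "\<dots> = tp (?p (Suc i)) (?p (n - i)) z - tp (?p i) (?p (Suc (n - i))) z"
        by (simp add: L_commutator)
      finally show ?thesis using that by (simp add: l_def Suc_diff_le del: odd_power_simps)
    qed
    then have l: "i \<le> Suc n \<Longrightarrow> l i = l 0 + real i *\<^sub>R D" for i
    proof (induction i)
      case (Suc i)
      have "l (Suc i) = l i + D" using Suc.prems(1) Suc.prems(2)[of i] by (metis Suc_le_mono add.commute diff_add_cancel)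
      then show ?case using Suc by (simp add: scaleR_add_left)
    qed simp
    have "tp a (?p n) a = tp (?p n) a a"
      using W unfolding W_def by (metis add_0 odd_power_simps(1))
    then have "- D = tp (?p (Suc n)) a z - tp a (?p (Suc n)) z"
      using L_commutator[of "?p n" a a a z] tp_commute[of "?p n" a a] by (simp add: D_def)
    also have "\<dots> = l (Suc n) - l 0" by (simp add: l_def)
    also have "\<dots> = real (Suc n) *\<^sub>R D" using l[of "Suc n"] by simp
    finally have "(1 + real (Suc n)) *\<^sub>R D = 0"
      by (simp only: scaleR_add_left scaleR_one) (metis add.right_inverse)
    then have "D = 0" by simp
    then show ?thesis using l by (simp add: D_def l_def)
  qed
  have W: "W n" for n
  proof (induction n)
    case (Suc n)
    have "tp (?p i) (?p j) z = tp (?p (Suc n)) a z" if "i + j = Suc n" for i j z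
    proof -
      have "tp (?p i) (?p (Suc n - i)) z = tp (?p 0) (?p (Suc n)) z"
        "tp (?p (Suc n)) (?p (Suc n - Suc n)) z = tp (?p 0) (?p (Suc n)) z"
        using step[OF Suc] that by (metis le_add1, blast)
      moreover have "Suc n - i = j" using that by simp
      ultimately show ?thesis by (simp del: odd_power_simps(2))
    qed
    then show ?case by (simp add: W_def del: odd_power_simps)
  qed (simp add: W_def)
  show "i + j = n \<Longrightarrow> tp (?p i) (?p j) z = tp (?p n) a z" using W by (simp add: W_def)
  show "tp a (?p n) z = tp (?p n) a z" using W by (metis W_def add_0 odd_power_simps(1))
  show "tp a a (tp (?p n) a z) = tp (?p n) a (tp a a z)" using step[OF W] by blast
qed

text \<open>\<open>L_odd_power\<close> reduces the first two arguments to one operator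
  \<open>L(a\<^sub>n, a)\<close>, which commutes with \<open>L(a,a)\<close>, so induction on
  \<open>k\<close> applies.\<close>

lemma tp_odd_power:
  "tp (odd_power a i) (odd_power a j) (odd_power a k) = odd_power a (Suc (i + j + k))"
proof (induction k)
  case 0
  show ?case using tp_commute[of "odd_power a (i + j)" a a] by (simp add: L_odd_power(1)[OF refl])
next
  case (Suc k)
  then show ?case by (simp add: L_odd_power(1)[OF refl] flip: L_odd_power(3))
qed

text \<open>Real scalars matter: \<open>tp a x z = tp x a z\<close> compares a conjugate linear with
  a linear map in \<open>x\<close>, and so extends from odd powers only to real combinations and
  their limits.\<close>

definition odd_span :: "'a \<Rightarrow> 'a set" where
  "odd_span a = closure (real_vector.span (range (odd_power a)))"

lemma subspace_odd_span: "real_vector.subspace (odd_span a)"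
  unfolding odd_span_def by (intro subspace_closure real_vector.subspace_span)

lemma closed_odd_span: "closed (odd_span a)"
  by (simp add: odd_span_def)

lemma odd_power_in_odd_span: "odd_power a k \<in> odd_span a"
  unfolding odd_span_def by (meson closure_subset range_eqI real_vector.span_base subsetD)

lemma self_in_odd_span [simp]: "a \<in> odd_span a"
  using odd_power_in_odd_span[of a 0] by simp

lemma odd_span_subset:
  assumes "real_vector.subspace S" "closed S" "\<And>k. odd_power a k \<in> S"
  shows "odd_span a \<subseteq> S"
  unfolding odd_span_def using assms by (intro closure_minimal real_vector.span_minimal) auto

lemma bounded_linear_odd_span_image:
  assumes "x \<in> odd_span a" "bounded_linear f" "\<And>k. f (odd_power a k) \<in> odd_span a"
  shows "f x \<in> odd_span a"
proof -
  interpret f: bounded_linear f by fact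
  have "odd_span a \<subseteq> f -` odd_span a"
  proof (rule odd_span_subset)
    show "real_vector.subspace (f -` odd_span a)"
      using subspace_odd_span[of a]
      by (auto simp: real_vector.subspace_def f.add f.scaleR f.zero)
    show "closed (f -` odd_span a)"
      by (intro closed_vimage closed_odd_span f.continuous_on continuous_on_id)
  qed (use assms in auto)
  with assms(1) show ?thesis by auto
qed

lemma bounded_linear_odd_span_eq:
  assumes "x \<in> odd_span a" "bounded_linear f" "bounded_linear g"
    "\<And>k. f (odd_power a k) = g (odd_power a k)"
  shows "f x = g x"
proof -
  interpret f: bounded_linear f by fact
  interpret g: bounded_linear g by fact
  have "odd_span a \<subseteq> {x. f x = g x}"
  proof (rule odd_span_subset)
    show "real_vector.subspace {x. f x = g x}"
      by (auto simp: real_vector.subspace_def f.add f.scaleR f.zero g.add g.scaleR g.zero)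
    show "closed {x. f x = g x}"
      by (intro closed_Collect_eq f.continuous_on g.continuous_on continuous_on_id)
  qed (use assms in auto)
  with assms(1) show ?thesis by auto
qed

lemma odd_span_L_swap:
  assumes "x \<in> odd_span a"
  shows "tp a x z = tp x a z"
  by (rule bounded_linear_odd_span_eq[OF assms bounded_linear_tp_mid bounded_linear_tp_left L_odd_power(2)])

lemma odd_span_L: "x \<in> odd_span a \<Longrightarrow> tp a a x \<in> odd_span a"
  by (erule bounded_linear_odd_span_image[OF _ bounded_linear_tp_right])
    (simp add: odd_power_in_odd_span flip: odd_power_simps)

lemma odd_span_tp:
  assumes "x \<in> odd_span a" "y \<in> odd_span a" "z \<in> odd_span a"
  shows "tp x y z \<in> odd_span a"
proof -
  have 1: "tp x (odd_power a j) (odd_power a k) \<in> odd_span a" for j k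
    by (rule bounded_linear_odd_span_image[OF assms(1) bounded_linear_tp_left])
      (simp only: tp_odd_power odd_power_in_odd_span)
  have 2: "tp x y (odd_power a k) \<in> odd_span a" for k
    by (rule bounded_linear_odd_span_image[OF assms(2) bounded_linear_tp_mid 1])
  show ?thesis
    by (rule bounded_linear_odd_span_image[OF assms(3) bounded_linear_tp_right 2])
qed

text \<open>On odd powers both sides are the odd power of the next index; density extends the
  equations one slot at a time.\<close>

lemma odd_span_L_tp:
  assumes "x \<in> odd_span a" "y \<in> odd_span a" "z \<in> odd_span a"
  shows "tp (tp a a x) y z = tp a a (tp x y z)" "tp x (tp a a y) z = tp a a (tp x y z)"
proof -
  note bl = bounded_linear_compose[OF bounded_linear_tp_right bounded_linear_tp_left]
    bounded_linear_compose[OF bounded_linear_tp_right bounded_linear_tp_mid]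
    bounded_linear_compose[OF bounded_linear_tp_right bounded_linear_tp_right]
    bounded_linear_compose[OF bounded_linear_tp_left bounded_linear_tp_right]
    bounded_linear_compose[OF bounded_linear_tp_mid bounded_linear_tp_right]
    bounded_linear_tp_left bounded_linear_tp_mid bounded_linear_tp_right
  let ?p = "odd_power a"
  have p: "tp (tp a a (?p i)) (?p j) (?p k) = tp a a (tp (?p i) (?p j) (?p k))"
    "tp (?p i) (tp a a (?p j)) (?p k) = tp a a (tp (?p i) (?p j) (?p k))" for i j k
    using tp_odd_power[of a "Suc i" j k] tp_odd_power[of a i "Suc j" k] by (simp_all add: tp_odd_power)
  have 1: "tp (tp a a x) (?p j) (?p k) = tp a a (tp x (?p j) (?p k))" for j k
    by (rule bounded_linear_odd_span_eq[OF assms(1)]) (intro bl p)+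
  have 2: "tp (tp a a x) y (?p k) = tp a a (tp x y (?p k))" for k
    by (rule bounded_linear_odd_span_eq[OF assms(2)]) (intro bl 1)+
  show "tp (tp a a x) y z = tp a a (tp x y z)"
    by (rule bounded_linear_odd_span_eq[OF assms(3)]) (intro bl 2)+
  have 1: "tp x (tp a a (?p j)) (?p k) = tp a a (tp x (?p j) (?p k))" for j k
    by (rule bounded_linear_odd_span_eq[OF assms(1)]) (intro bl p)+
  have 2: "tp x (tp a a y) (?p k) = tp a a (tp x y (?p k))" for k
    by (rule bounded_linear_odd_span_eq[OF assms(2)]) (intro bl 1)+
  show "tp x (tp a a y) z = tp a a (tp x y z)"
    by (rule bounded_linear_odd_span_eq[OF assms(3)]) (intro bl 2)+
qed

text \<open>Closure under sums, real multiples, compositions and pointwise limits puts convergent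
  real power series in \<open>L(a,a)\<close> here. The outer slot on the right is covered by
  \<open>tp_commute\<close>.\<close>

definition centroid :: "'a \<Rightarrow> ('a \<Rightarrow> 'a) \<Rightarrow> bool" where
  "centroid a P \<longleftrightarrow> (\<forall>x\<in>odd_span a. P x \<in> odd_span a \<and> P (tp a a x) = tp a a (P x) \<and>
     (\<forall>y\<in>odd_span a. \<forall>z\<in>odd_span a. tp (P x) y z = P (tp x y z) \<and> tp y (P x) z = P (tp y x z)))"

lemma centroidD:
  assumes "centroid a P" "x \<in> odd_span a"
  shows "P x \<in> odd_span a" "P (tp a a x) = tp a a (P x)"
    "y \<in> odd_span a \<Longrightarrow> z \<in> odd_span a \<Longrightarrow> tp (P x) y z = P (tp x y z)"
    "y \<in> odd_span a \<Longrightarrow> z \<in> odd_span a \<Longrightarrow> tp y (P x) z = P (tp y x z)"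
  using assms by (auto simp: centroid_def)

lemma centroid_ident: "centroid a (\<lambda>x. x)"
  by (simp add: centroid_def)

lemma centroid_L: "centroid a (tp a a)"
  by (simp add: centroid_def odd_span_L odd_span_L_tp)

lemma centroid_compose: "centroid a P \<Longrightarrow> centroid a R \<Longrightarrow> centroid a (\<lambda>x. P (R x))"
  by (simp add: centroid_def odd_span_tp odd_span_L)

lemma centroid_funpow: "centroid a P \<Longrightarrow> centroid a (P ^^ n)"
  by (induction n) (auto intro: centroid_compose simp: centroid_ident comp_def id_def)

lemma centroid_add: "centroid a P \<Longrightarrow> centroid a R \<Longrightarrow> centroid a (\<lambda>x. P x + R x)"
  by (simp add: centroid_def tp_simps real_vector.subspace_add[OF subspace_odd_span])

lemma centroid_zero: "centroid a (\<lambda>x. 0)"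
  by (simp add: centroid_def real_vector.subspace_0[OF subspace_odd_span])

lemma centroid_scaleR: "centroid a P \<Longrightarrow> centroid a (\<lambda>x. r *\<^sub>R P x)"
  by (simp add: centroid_def tp_simps real_vector.subspace_scale[OF subspace_odd_span])

lemma centroid_sum: "(\<And>i. i \<in> I \<Longrightarrow> centroid a (P i)) \<Longrightarrow> centroid a (\<lambda>x. \<Sum>i\<in>I. P i x)"
  by (induction I rule: infinite_finite_induct) (auto intro: centroid_add simp: centroid_zero)

lemma centroid_limit:
  assumes P: "\<And>n. centroid a (P n)" and lim: "\<And>x. (\<lambda>n. P n x) \<longlonglongrightarrow> R x"
  shows "centroid a R"
  unfolding centroid_def
proof (intro ballI conjI)
  fix x assume x: "x \<in> odd_span a"
  show "R x \<in> odd_span a"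
    by (rule Lim_in_closed_set[OF closed_odd_span _ _ lim[of x]]) (auto simp: centroidD[OF P x])
  show "R (tp a a x) = tp a a (R x)"
    using LIMSEQ_unique[OF lim[of "tp a a x"]] tp_tendsto[OF tendsto_const tendsto_const lim[of x], of a a]
    by (simp add: centroidD[OF P x])
  fix y z assume yz: "y \<in> odd_span a" "z \<in> odd_span a"
  show "tp (R x) y z = R (tp x y z)"
    using LIMSEQ_unique[OF lim[of "tp x y z"]] tp_tendsto[OF lim[of x] tendsto_const tendsto_const, of y z]
    by (simp add: centroidD(3)[OF P x yz])
  show "tp y (R x) z = R (tp y x z)"
    using LIMSEQ_unique[OF lim[of "tp y x z"]] tp_tendsto[OF tendsto_const lim[of x] tendsto_const, of y z]
    by (simp add: centroidD(4)[OF P x yz])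
qed

text \<open>Pulling \<open>P\<close> out of the three slots in turn gains one factor
  \<open>L(a,a)\<close>, while the norm axiom evaluates the left side as
  \<open>norm (P a) ^ 3\<close>.\<close>

lemma centroid_cube:
  assumes "centroid a P"
  shows "tp (P a) (P a) (P a) = P (P (P (tp a a a)))"
proof -
  note P = centroidD[OF assms] and F = self_in_odd_span odd_span_tp
  have "tp (P a) (P a) (P a) = P (tp a (P a) (P a))" by (intro P F)
  also have "tp a (P a) (P a) = P (tp a a (P a))" by (intro P F)
  also have "tp a a (P a) = P (tp a a a)" by (rule P(2)[symmetric]) simp
  finally show ?thesis .
qed

end

section \<open>Regularity from a positive conorm\<close>

text \<open>The termwise form of \<open>exp (i s) + exp (- i s) = 2 cos s\<close>.\<close>

lemma exp_term_plus_minus: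
  "(\<i> * complex_of_real t) ^ n / fact n + (\<i> * complex_of_real (- t)) ^ n / fact n
     = complex_of_real (2 * (cos_coeff n * t ^ n))"
proof (cases "even n")
  case True
  then obtain m where n: "n = 2 * m" by blast
  have "\<i> ^ n = (- 1) ^ m" by (simp add: n power_mult)
  then show ?thesis using True by (simp add: cos_coeff_def n power_mult_distrib)
next
  case False
  then show ?thesis by (simp add: cos_coeff_def power_mult_distrib)
qed

lemma abs_cos_coeff_le: "\<bar>cos_coeff n\<bar> \<le> 1 / fact n"
  by (simp add: cos_coeff_def abs_mult power_abs)

locale jb_triple_point = jb_triple sc tp for sc :: "complex \<Rightarrow> 'a::banach \<Rightarrow> 'a" and tp +
  fixes a :: 'a
begin

abbreviation T :: "'a \<Rightarrow> 'a" where "T \<equiv> tp a a"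

definition K :: real where "K = 16 * norm a ^ 2"
text \<open>\<open>K\<close> bounds the norm of \<open>T\<close>, and
  \<open>t * K \<le> 1 / 2\<close> dominates the series by a geometric one and keeps the cosine
  remainder below its quadratic term.\<close>

definition t :: real where "t = 1 / (2 * (K + 1))"

lemma K_nonneg: "K \<ge> 0" by (simp add: K_def)

lemma t_pos: "t > 0" using K_nonneg by (simp add: t_def)

lemma t_K_le: "t * K \<le> 1 / 2" using K_nonneg by (simp add: t_def field_simps)

lemma norm_T_le: "norm (T x) \<le> K * norm x"
  using norm_tp_le[of a a x] by (simp add: K_def power2_eq_square mult_ac)

lemma norm_T_power_le: "norm ((T ^^ n) x) \<le> K ^ n * norm x"
proof (induction n)
  case (Suc n)
  have "norm (T ((T ^^ n) x)) \<le> K * norm ((T ^^ n) x)" by (rule norm_T_le)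
  also have "\<dots> \<le> K * (K ^ n * norm x)" using Suc K_nonneg by (intro mult_left_mono)
  finally show ?case by simp
qed simp

lemma linear_T_power: "linear (T ^^ n)"
proof (induction n)
  case (Suc n)
  show ?case
    by (rule linearI) (simp_all add: linear_add[OF Suc] linear_scale[OF Suc] tp_simps)
qed (simp add: linearI)

lemma t_K_power_le: "(t * K) ^ n \<le> (1 / 2) ^ n"
  using t_pos K_nonneg t_K_le by (intro power_mono) auto

lemma norm_series_term_le:
  assumes "cmod c \<le> t ^ n"
  shows "norm (sc c ((T ^^ n) x)) \<le> (1 / 2) ^ n * norm x"
proof -
  have "norm (sc c ((T ^^ n) x)) = cmod c * norm ((T ^^ n) x)" by (rule norm_sc)
  also have "\<dots> \<le> t ^ n * (K ^ n * norm x)"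
    using assms norm_T_power_le t_pos by (intro mult_mono) auto
  also have "\<dots> = (t * K) ^ n * norm x" by (simp add: power_mult_distrib)
  also have "\<dots> \<le> (1 / 2) ^ n * norm x" using t_K_power_le by (intro mult_right_mono) auto
  finally show ?thesis .
qed

lemma summable_half_powers: "summable (\<lambda>n. (1 / 2) ^ n * norm (x :: 'a))"
  by (intro summable_mult2 summable_geometric) simp

lemma summable_series:
  assumes "\<And>n. cmod (c n) \<le> t ^ n"
  shows "summable (\<lambda>n. sc (c n) ((T ^^ n) x))"
  by (rule summable_comparison_test[OF _ summable_half_powers[of x]])
    (use norm_series_term_le[OF assms] in auto)

text \<open>\<open>C\<close> is \<open>cos (t L(a,a))\<close>: as a real power series in \<open>L(a,a)\<close> it preserves the real span of the odd
  powers, and it is a contraction because it averages the isometries \<open>exp (i t L(a,a))\<close> and \<open>exp (- i t L(a,a))\<close>.\<close>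

definition C_term :: "nat \<Rightarrow> 'a \<Rightarrow> 'a" where
  "C_term n x = (cos_coeff n * t ^ n) *\<^sub>R (T ^^ n) x"

definition C :: "'a \<Rightarrow> 'a" where "C x = (\<Sum>n. C_term n x)"

lemma cmod_exp_coeff_le:
  "\<bar>s\<bar> = t \<Longrightarrow> cmod ((\<i> * complex_of_real s) ^ n / fact n) \<le> t ^ n"
  using t_pos by (simp add: norm_divide norm_power norm_mult divide_le_eq mult_le_cancel_left1 fact_ge_1)

lemma summable_C_term: "summable (\<lambda>n. C_term n x)"
proof -
  have "\<bar>cos_coeff n * t ^ n\<bar> \<le> t ^ n" for n
  proof -
    have "\<bar>cos_coeff n\<bar> * t ^ n \<le> 1 * t ^ n"
      using abs_cos_coeff_le[of n] fact_ge_1[of n, where 'a = real] t_pos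
      by (intro mult_right_mono order_trans[OF abs_cos_coeff_le]) auto
    then show ?thesis using t_pos by (simp add: abs_mult)
  qed
  then show ?thesis
    using summable_series[of "\<lambda>n. complex_of_real (cos_coeff n * t ^ n)" x]
    by (simp add: C_term_def sc_of_real del: of_real_mult of_real_power)
qed

lemma C_limit: "(\<lambda>n. \<Sum>i<n. C_term i x) \<longlonglongrightarrow> C x"
  unfolding C_def by (rule summable_LIMSEQ[OF summable_C_term])

lemma linear_C: "linear C"
proof (rule linearI)
  show "C (x + y) = C x + C y" for x y
    unfolding C_def suminf_add[OF summable_C_term summable_C_term]
    by (simp add: C_term_def linear_add[OF linear_T_power] scaleR_add_right)
  show "C (r *\<^sub>R x) = r *\<^sub>R C x" for r x
  proof -
    have "C_term n (r *\<^sub>R x) = r *\<^sub>R C_term n x" for n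
      by (simp add: C_term_def linear_scale[OF linear_T_power] mult_ac)
    then show ?thesis by (simp add: C_def suminf_scaleR_right[OF summable_C_term])
  qed
qed

lemma centroid_T_power: "centroid a (T ^^ n)"
  by (rule centroid_funpow[OF centroid_L])

lemma centroid_C: "centroid a C"
  by (rule centroid_limit[OF _ C_limit])
    (auto simp: C_term_def intro!: centroid_sum centroid_scaleR centroid_T_power)

lemma operator_exp_eq:
  "operator_exp sc (\<lambda>y. sc c (T y)) x = (\<Sum>n. sc (c ^ n / fact n) ((T ^^ n) x))"
proof -
  have "Vector_Spaces.linear sc sc T"
    using hermitian[of a] by (simp add: hermitian_operator_def bounded_clinear_def)
  from funpow_scale_linear[OF this] show ?thesis by (simp add: operator_exp_def sc_sc)
qed

lemma norm_exp_eq: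
  "norm (\<Sum>n. sc ((\<i> * complex_of_real s) ^ n / fact n) ((T ^^ n) x)) = norm x"
  using hermitian[of a] by (simp add: hermitian_operator_def flip: operator_exp_eq)

lemma norm_C_le: "norm (C x) \<le> norm x"
proof -
  let ?e = "\<lambda>s n. sc ((\<i> * complex_of_real s) ^ n / fact n) ((T ^^ n) x)"
  have summ: "summable (?e t)" "summable (?e (- t))"
    using t_pos by - (rule summable_series, rule cmod_exp_coeff_le, simp)+
  have e_eq: "?e t n + ?e (- t) n = 2 *\<^sub>R C_term n x" for n
  proof -
    have "?e t n + ?e (- t) n = sc (complex_of_real (2 * (cos_coeff n * t ^ n))) ((T ^^ n) x)"
      unfolding exp_term_plus_minus[symmetric] by (simp only: scale_left_distrib)
    then show ?thesis by (simp only: sc_of_real C_term_def scaleR_scaleR)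
  qed
  have "suminf (?e t) + suminf (?e (- t)) = (\<Sum>n. ?e t n + ?e (- t) n)"
    by (rule suminf_add[OF summ])
  also have "\<dots> = (\<Sum>n. 2 *\<^sub>R C_term n x)" by (simp only: e_eq)
  also have "\<dots> = 2 *\<^sub>R C x" by (simp add: C_def suminf_scaleR_right[OF summable_C_term])
  finally have "2 * norm (C x) = norm (suminf (?e t) + suminf (?e (- t)))" by simp
  also have "\<dots> \<le> norm x + norm x"
    by (rule order_trans[OF norm_triangle_ineq]) (simp only: norm_exp_eq order_refl)
  finally show ?thesis by simp
qed

text \<open>The quadratic term of \<open>x - C x\<close> is \<open>t^2/2\<close> times
  \<open>T (T x)\<close>. The terms from index 3 on add up to at most \<open>t^2/6\<close> times its
  norm, since \<open>1/3! = 1/6\<close> and the factors \<open>(t * K) ^ Suc n\<close> sum to at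
  most 1. The difference is \<open>t^2/3\<close>.\<close>

lemma norm_T_T_le: "t ^ 2 * norm (T (T x)) \<le> 3 * norm (x - C x)"
proof -
  have term_le: "norm (C_term (n + 3) x) \<le> t ^ 2 / 6 * norm (T (T x)) * (1 / 2) ^ Suc n" for n
  proof -
    have f6: "(6::real) \<le> fact (n + 3)"
      using fact_mono[of 3 "n + 3", where 'a = real] by (simp add: numeral_3_eq_3)
    have "(T ^^ (n + 3)) x = (T ^^ (n + 1)) (T (T x))"
      by (simp add: funpow_swap1 numeral_3_eq_3)
    then have "norm (C_term (n + 3) x) = \<bar>cos_coeff (n + 3)\<bar> * t ^ (n + 3) * norm ((T ^^ (n + 1)) (T (T x)))"
      using t_pos by (simp add: C_term_def abs_mult)
    also have "\<dots> \<le> 1 / 6 * t ^ (n + 3) * (K ^ (n + 1) * norm (T (T x)))"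
      using t_pos K_nonneg f6
      by (intro mult_mono order_trans[OF abs_cos_coeff_le] norm_T_power_le) (auto simp: field_simps)
    also have "\<dots> = t ^ 2 / 6 * norm (T (T x)) * (t * K) ^ Suc n"
      by (simp add: power_mult_distrib power_add power2_eq_square power3_eq_cube)
    also have "\<dots> \<le> t ^ 2 / 6 * norm (T (T x)) * (1 / 2) ^ Suc n"
      by (intro mult_left_mono t_K_power_le) auto
    finally show ?thesis .
  qed
  have geo: "(\<lambda>n. t ^ 2 / 6 * norm (T (T x)) * (1 / 2) ^ Suc n) sums (t ^ 2 / 6 * norm (T (T x)) * 1)"
    by (intro sums_mult power_half_series)
  have tail: "norm (\<Sum>n. C_term (n + 3) x) \<le> t ^ 2 / 6 * norm (T (T x))"
    using norm_suminf_le[OF term_le sums_summable[OF geo]] sums_unique[OF geo] by simp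
  have "C x = (\<Sum>n. C_term (n + 3) x) + (\<Sum>n<3. C_term n x)"
    unfolding C_def by (rule suminf_split_initial_segment[OF summable_C_term])
  also have "(\<Sum>n<3. C_term n x) = x - (t ^ 2 / 2) *\<^sub>R T (T x)"
    by (simp add: C_term_def numeral_3_eq_3 cos_coeff_def power2_eq_square)
  finally have "(t ^ 2 / 2) *\<^sub>R T (T x) = (x - C x) + (\<Sum>n. C_term (n + 3) x)"
    by (simp add: algebra_simps)
  then have "t ^ 2 / 2 * norm (T (T x)) \<le> norm (x - C x) + norm (\<Sum>n. C_term (n + 3) x)"
    using norm_triangle_ineq[of "x - C x"] by (metis abs_of_nonneg norm_scaleR zero_le_divide_iff zero_le_numeral zero_le_power2)
  with tail show ?thesis by (simp add: field_simps)
qed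

section \<open>Mean ergodic argument for the contraction \<open>C\<close>\<close>

lemma norm_C_power_le: "norm ((C ^^ n) x) \<le> norm x"
  by (induction n) (auto intro: order_trans[OF norm_C_le])

definition cesaro :: "nat \<Rightarrow> 'a \<Rightarrow> 'a" where
  "cesaro n x = (1 / real (Suc n)) *\<^sub>R (\<Sum>i\<le>n. (C ^^ i) x)"

lemma centroid_cesaro: "centroid a (cesaro n)"
  unfolding cesaro_def by (intro centroid_scaleR centroid_sum centroid_funpow centroid_C)

lemma norm_cesaro_le: "norm (cesaro n x) \<le> norm x"
proof -
  have "norm (\<Sum>i\<le>n. (C ^^ i) x) \<le> real (Suc n) * norm x"
    using sum_norm_bound[of "{..n}" "\<lambda>i. (C ^^ i) x" "norm x"] norm_C_power_le by simp
  then show ?thesis by (simp add: cesaro_def field_simps)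
qed

text \<open>The sum telescopes to \<open>x - (C ^^ Suc n) x\<close>, which is bounded independently
  of \<open>n\<close>.\<close>

lemma cesaro_minus_C: "norm (cesaro n x - C (cesaro n x)) \<le> 2 * norm x / real (Suc n)"
proof -
  have "cesaro n x - C (cesaro n x) = (1 / real (Suc n)) *\<^sub>R (\<Sum>i\<le>n. (C ^^ i) x - (C ^^ Suc i) x)"
    by (simp add: cesaro_def linear_scale[OF linear_C] linear_sum[OF linear_C] sum_subtractf scaleR_diff_right)
  also have "(\<Sum>i\<le>n. (C ^^ i) x - (C ^^ Suc i) x) = x - (C ^^ Suc n) x"
    by (subst sum_telescope) simp
  finally have "norm (cesaro n x - C (cesaro n x)) = norm (x - (C ^^ Suc n) x) / real (Suc n)"
    by simp
  also have "\<dots> \<le> 2 * norm x / real (Suc n)"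
    using norm_triangle_ineq4[of x "(C ^^ Suc n) x"] norm_C_power_le[of "Suc n" x]
    by (intro divide_right_mono) auto
  finally show ?thesis .
qed

text \<open>Iterating the cube twice produces enough factors \<open>L(a,a)\<close> to exploit the decay of
  \<open>(1 - C)\<close> on Cesaro means.\<close>

lemma norm_cesaro_power9_le: "t ^ 2 * norm (cesaro n a) ^ 9 \<le> K ^ 2 * (6 * norm a / real (Suc n))"
proof -
  let ?P = "cesaro n"
  let ?R = "\<lambda>x. ?P (?P (?P (T x)))"
  \<comment> \<open>Two cubings yield nine factors \<open>?P\<close> and four factors
    \<open>T\<close>. Eight of the \<open>?P\<close> go into \<open>y\<close>; two \<open>T\<close>
    are bounded by \<open>K\<close>, and the other two act on the mean \<open>?P y\<close>, where
    \<open>norm_T_T_le\<close> makes them decay.\<close>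
  define y where "y = ?P (?P (?P (?P (?P (?P (?P (?P a)))))))"
  note cP = centroid_cesaro[of n]
  have cR: "centroid a ?R"
    by (rule centroid_compose[OF cP centroid_compose[OF cP centroid_compose[OF cP centroid_L]]])
  have 1: "norm (?P a) ^ 3 = norm (?R a)"
    by (simp add: centroid_cube[OF cP] flip: norm_cube)
  have "norm (?R a) ^ 3 = norm (?R (?R (?R (T a))))"
    by (simp add: centroid_cube[OF cR] flip: norm_cube)
  also have "?R (?R (?R (T a))) = T (T (T (T (?P y))))"
    by (simp add: y_def centroidD(1,2)[OF cP] odd_span_L)
  finally have "norm (?P a) ^ 9 = norm (T (T (T (T (?P y)))))"
    unfolding 1[symmetric] by (simp flip: power_mult)
  also have "\<dots> \<le> K * (K * norm (T (T (?P y))))"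
    using K_nonneg by (intro order_trans[OF norm_T_le] mult_left_mono norm_T_le) auto
  finally have "t ^ 2 * norm (?P a) ^ 9 \<le> t ^ 2 * (K ^ 2 * norm (T (T (?P y))))"
    by (intro mult_left_mono) (auto simp: power2_eq_square mult_ac)
  also have "\<dots> = K ^ 2 * (t ^ 2 * norm (T (T (?P y))))" by simp
  also have "\<dots> \<le> K ^ 2 * (3 * (2 * norm y / real (Suc n)))"
    using order_trans[OF norm_T_T_le mult_left_mono[OF cesaro_minus_C]] by (intro mult_left_mono) auto
  also have "\<dots> \<le> K ^ 2 * (3 * (2 * norm a / real (Suc n)))"
  proof -
    have "norm y \<le> norm a" unfolding y_def by (meson norm_cesaro_le order_trans)
    then show ?thesis by (intro mult_left_mono divide_right_mono) auto
  qed
  finally show ?thesis by simp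
qed

lemma cesaro_self_tendsto_0: "(\<lambda>n. cesaro n a) \<longlonglongrightarrow> 0"
proof -
  have lim: "(\<lambda>n. K ^ 2 * (6 * norm a / real (Suc n)) / t ^ 2) \<longlonglongrightarrow> 0"
    using tendsto_mult_right_zero[OF LIMSEQ_inverse_real_of_nat, of "K ^ 2 * (6 * norm a) / t ^ 2"]
    by (simp add: divide_inverse mult_ac)
  have le: "norm (norm (cesaro n a) ^ 9) \<le> K ^ 2 * (6 * norm a / real (Suc n)) / t ^ 2" for n
  proof -
    have "norm (cesaro n a) ^ 9 * t ^ 2 \<le> K ^ 2 * (6 * norm a / real (Suc n))"
      using norm_cesaro_power9_le[of n] by (simp only: mult.commute)
    moreover have "0 < t ^ 2" using t_pos by simp
    ultimately have "norm (cesaro n a) ^ 9 \<le> K ^ 2 * (6 * norm a / real (Suc n)) / t ^ 2"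
      using pos_le_divide_eq by blast
    then show ?thesis by (simp only: real_norm_def abs_of_nonneg[OF zero_le_power[OF norm_ge_zero]])
  qed
  have "(\<lambda>n. norm (cesaro n a) ^ 9) \<longlonglongrightarrow> 0"
    by (rule Lim_null_comparison[OF always_eventually[OF allI[OF le]] lim])
  then have "(\<lambda>n. root 9 (norm (cesaro n a) ^ 9)) \<longlonglongrightarrow> root 9 0"
    by (rule tendsto_real_root)
  then show ?thesis by (simp add: real_root_power_cancel tendsto_norm_zero_iff)
qed

section \<open>Density of the range of \<open>L(a,a)\<close> in the odd span\<close>

lemma L_range_closure:
  shows "real_vector.subspace (closure (T ` odd_span a))" (is "real_vector.subspace ?H")
    and "x \<in> odd_span a \<Longrightarrow> x - C x \<in> closure (T ` odd_span a)"
proof -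
  show H: "real_vector.subspace ?H"
    by (intro subspace_closure real_vector.linear_subspace_image[OF linear_tp_right] subspace_odd_span)
  assume x: "x \<in> odd_span a"
  \<comment> \<open>Starting at \<open>Suc n\<close> keeps the constant term \<open>x\<close> of the
    cosine series in every partial sum; after cancelling it only positive powers of \<open>T\<close>
    remain.\<close>
  have "x - (\<Sum>i<Suc n. C_term i x) \<in> ?H" for n
  proof -
    have "C_term (Suc i) x \<in> ?H" for i
    proof -
      have "T ((T ^^ i) x) \<in> ?H"
        using centroidD(1)[OF centroid_T_power x] closure_subset by blast
      then show ?thesis by (simp add: C_term_def real_vector.subspace_scale[OF H])
    qed
    then have "(\<Sum>i<n. C_term (Suc i) x) \<in> ?H" by (intro real_vector.subspace_sum[OF H])
    moreover have "x - (\<Sum>i<Suc n. C_term i x) = - (\<Sum>i<n. C_term (Suc i) x)"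
      unfolding sum.lessThan_Suc_shift by (simp add: C_term_def cos_coeff_def)
    ultimately show ?thesis by (simp add: real_vector.subspace_neg[OF H])
  qed
  moreover have "(\<lambda>n. x - (\<Sum>i<Suc n. C_term i x)) \<longlonglongrightarrow> x - C x"
    by (intro tendsto_diff tendsto_const LIMSEQ_Suc[OF C_limit])
  ultimately show "x - C x \<in> ?H" by (rule closed_sequentially[OF closed_closure])
qed

text \<open>Each \<open>1 - C^i\<close> telescopes into terms \<open>(1 - C) C^j\<close>, and
  averaging over \<open>i\<close> stays in the subspace.\<close>

lemma self_minus_cesaro: "a - cesaro n a \<in> closure (T ` odd_span a)" (is "_ \<in> ?H")
proof -
  note H = L_range_closure(1)
  have p: "a - (C ^^ i) a \<in> ?H" for i
  proof (induction i)
    case (Suc i)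
    have "(C ^^ i) a - C ((C ^^ i) a) \<in> ?H"
      by (intro L_range_closure(2) centroidD(1)[OF centroid_funpow[OF centroid_C]]) simp
    from real_vector.subspace_add[OF H Suc this] show ?case by simp
  qed (simp add: real_vector.subspace_0[OF H])
  have "a - cesaro n a = (1 / real (Suc n)) *\<^sub>R (\<Sum>i\<le>n. a - (C ^^ i) a)"
    by (simp add: cesaro_def sum_subtractf scaleR_diff_right sum_constant_scaleR)
  also have "\<dots> \<in> ?H" by (intro real_vector.subspace_scale[OF H] real_vector.subspace_sum[OF H] p)
  finally show ?thesis .
qed

text \<open>Higher odd powers lie in the range of \<open>T\<close> by construction. For
  \<open>a\<close> itself the ergodic argument applies: \<open>a - cesaro n a\<close> tends to
  \<open>a\<close>.\<close>

lemma odd_span_subset_L_closure: "odd_span a \<subseteq> closure (T ` odd_span a)"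
proof (rule odd_span_subset[OF L_range_closure(1) closed_closure])
  fix k
  show "odd_power a k \<in> closure (T ` odd_span a)"
  proof (cases k)
    case 0
    have "(\<lambda>n. a - cesaro n a) \<longlonglongrightarrow> a - 0"
      by (intro tendsto_diff tendsto_const cesaro_self_tendsto_0)
    from closed_sequentially[OF closed_closure self_minus_cesaro this] show ?thesis
      by (simp add: 0)
  next
    case (Suc k')
    then show ?thesis using odd_power_in_odd_span[of a k'] closure_subset by fastforce
  qed
qed

section \<open>Inverting \<open>L(a,a)\<close> on the odd span\<close>

lemma Q_odd_span_self: "x \<in> odd_span a \<Longrightarrow> tp a x a = T x"
  using odd_span_L_swap tp_commute by metis

text \<open>For \<open>x = T w = Q(a)w\<close> the fundamental formula gives
  \<open>Q(x) = Q(a)Q(w)Q(a)\<close>, which kills \<open>k\<close>; density of such \<open>x\<close>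
  does the rest.\<close>

lemma Q_odd_span_kernel:
  assumes "x \<in> odd_span a" and k: "tp a k a = 0"
  shows "tp x k x = 0"
proof -
  have 0: "tp (T w) k (T w) = 0" if "w \<in> odd_span a" for w
    using fundamental_formula[of a w k] Q_odd_span_self[OF that] k by simp
  have "x \<in> closure (T ` odd_span a)" using assms odd_span_subset_L_closure by blast
  then obtain f where f: "\<And>n. f n \<in> T ` odd_span a" "f \<longlonglongrightarrow> x"
    unfolding closure_sequential by blast
  have "(\<lambda>n. tp (f n) k (f n)) \<longlonglongrightarrow> tp x k x" by (rule tp_tendsto[OF f(2) tendsto_const f(2)])
  moreover have "tp (f n) k (f n) = 0" for n
    using f(1)[of n] by (rule imageE) (simp only: 0)
  ultimately show ?thesis by (simp add: LIMSEQ_const_iff)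
qed

text \<open>An element of the odd span cannot be close to the kernel of \<open>Q(a)\<close>: if
  \<open>k\<close> is in that kernel, then \<open>{x,x,x} = Q(x)(x - k)\<close>, hence
  \<open>norm x \<le> 16 * norm (x - k)\<close>. On the odd span \<open>Q(a)\<close> is
  \<open>T\<close>.\<close>

lemma L_bounded_below:
  assumes \<delta>: "\<delta> > 0" "lower_bound_mod (Q_op tp a) \<delta>" and x: "x \<in> odd_span a"
  shows "\<delta> * norm x \<le> 16 * norm (T x)"
proof (rule field_le_epsilon)
  fix \<epsilon> :: real assume "\<epsilon> > 0"
  define r where "r = (norm (T x) + \<epsilon> / 16) / \<delta>"
  have "norm (Q_op tp a x) < \<delta> * r"
    using \<delta> \<open>\<epsilon> > 0\<close> by (simp add: r_def Q_op_def Q_odd_span_self[OF x])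
  from lower_bound_modD[OF \<delta>(2) linear_Q \<delta>(1) this]
  obtain k where k: "tp a k a = 0" "norm (x - k) < r" by (auto simp: Q_op_def)
  have "norm x \<le> 16 * norm (x - k)"
  proof (cases "x = 0")
    case False
    have "norm x ^ 3 = norm (tp x (x - k) x)"
      by (simp add: tp_diff_mid Q_odd_span_kernel[OF x k(1)] norm_cube)
    also have "\<dots> \<le> 16 * norm x * norm (x - k) * norm x" by (rule norm_tp_le)
    finally have "norm x ^ 2 * norm x \<le> norm x ^ 2 * (16 * norm (x - k))"
      by (simp add: power2_eq_square power3_eq_cube mult_ac)
    then show ?thesis using False by simp
  qed simp
  then have "norm x \<le> 16 * r" using k(2) by simp
  then have "\<delta> * norm x \<le> 16 * (\<delta> * r)" using \<delta> by simp
  moreover have "\<delta> * r = norm (T x) + \<epsilon> / 16" using \<delta> by (simp add: r_def)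
  ultimately show "\<delta> * norm x \<le> 16 * norm (T x) + \<epsilon>" by linarith
qed

lemma von_neumann_regular_of_lower_bound:
  assumes \<delta>: "\<delta> > 0" "lower_bound_mod (Q_op tp a) \<delta>"
  shows "von_neumann_regular tp a"
proof -
  note below = L_bounded_below[OF \<delta>] and F = subspace_odd_span[of a]
  have "a \<in> closure (T ` odd_span a)" using odd_span_subset_L_closure by auto
  then obtain f where f: "\<And>n. f n \<in> T ` odd_span a" "f \<longlonglongrightarrow> a"
    unfolding closure_sequential by blast
  then obtain w where w: "\<And>n. w n \<in> odd_span a" "\<And>n. f n = T (w n)"
    unfolding image_iff by metis
  \<comment> \<open>The lower bound makes preimages of a convergent sequence converge, so
    \<open>a\<close> is attained by \<open>T\<close> and not only approximated.\<close>
  have "Cauchy w"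
  proof (rule CauchyI)
    fix e :: real assume "e > 0"
    then have "\<delta> * e / 16 > 0" using \<delta> by simp
    then obtain M where M: "\<And>m n. m \<ge> M \<Longrightarrow> n \<ge> M \<Longrightarrow> norm (f m - f n) < \<delta> * e / 16"
      using CauchyD[OF LIMSEQ_imp_Cauchy[OF f(2)]] by blast
    have "norm (w m - w n) < e" if "m \<ge> M" "n \<ge> M" for m n
    proof -
      have "\<delta> * norm (w m - w n) \<le> 16 * norm (T (w m - w n))"
        by (intro below real_vector.subspace_diff[OF F] w)
      also have "\<dots> < \<delta> * e" using M[OF that] by (simp add: w(2) tp_diff_right)
      finally show ?thesis using \<delta> by simp
    qed
    then show "\<exists>M. \<forall>m\<ge>M. \<forall>n\<ge>M. norm (w m - w n) < e" by blast
  qed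
  then obtain b where lim: "w \<longlonglongrightarrow> b" using Cauchy_convergent convergent_def by blast
  have b: "b \<in> odd_span a" by (rule closed_sequentially[OF closed_odd_span w(1) lim])
  have Tb: "T b = a"
    using LIMSEQ_unique[OF tp_tendsto[OF tendsto_const tendsto_const lim, of a a]] f(2)
    by (simp flip: w(2))
  have Qab: "tp a b a = a" using Q_odd_span_self[OF b] Tb by simp
  have Qba: "tp b a b = b"
  proof -
    \<comment> \<open>\<open>T\<close> is injective on the odd span, so the equation may be checked
      after applying it.\<close>
    have "T (tp b a b - b) = tp (T b) a b - T b"
      by (simp add: tp_diff_right odd_span_L_tp[OF b _ b])
    then have "T (tp b a b - b) = 0" by (simp add: Tb)
    moreover have "tp b a b - b \<in> odd_span a"
      by (intro real_vector.subspace_diff[OF F] odd_span_tp b) simp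
    ultimately show ?thesis using below[of "tp b a b - b"] \<delta> by (simp add: mult_le_0_iff)
  qed
  \<comment> \<open>Both products equal \<open>2L^2 - L\<close> for the common operator
    \<open>L = L(a,b) = L(b,a)\<close>.\<close>
  have "tp a (tp b z b) a = tp b (tp a z a) b" for z
  proof -
    have "tp a (tp b z b) a = 2 *\<^sub>R tp a b (tp a b z) - tp a b z"
      using Q_Q_eq[of a b z] by (simp add: Qab)
    also have "\<dots> = tp b (tp a z a) b"
      using Q_Q_eq[of b a z] by (simp add: Qba odd_span_L_swap[OF b])
    finally show ?thesis .
  qed
  then show ?thesis using Qab Qba unfolding von_neumann_regular_def Q_op_def
    by (intro exI[of _ b]) (auto simp: fun_eq_iff)
qed

end

theorem theorem3p3:
  fixes sc :: "complex \<Rightarrow> 'a::banach \<Rightarrow> 'a"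
    and tp :: "'a \<Rightarrow> 'a \<Rightarrow> 'a \<Rightarrow> 'a"
    and a :: 'a
  assumes "jb_triple sc tp"
    and "extremally_rich tp"
  shows "isCont (quadratic_conorm tp) a \<longleftrightarrow>
    \<not> von_neumann_regular tp a \<or> a \<in> bp_quasi_invertibles tp"
proof -
  interpret jb_triple_point sc tp a using assms(1) by (simp add: jb_triple_point_def)
  \<comment> \<open>This turns failure of the algebraic regularity condition into a vanishing
    conorm, where upper semicontinuity alone gives continuity.\<close>
  have "quadratic_conorm tp a = 0" if "\<not> von_neumann_regular tp a"
  proof (rule ccontr)
    assume "quadratic_conorm tp a \<noteq> 0"
    then have "0 < quadratic_conorm tp a" using quadratic_conorm_nonneg[of a] by simp
    then obtain \<delta> where \<delta>: "0 < ereal \<delta>" "ereal \<delta> < quadratic_conorm tp a"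
      using ereal_dense2 by blast
    then have "lower_bound_mod (Q_op tp a) \<delta>"
      by (subst le_quadratic_conorm_iff[symmetric]) auto
    with \<delta> that show False using von_neumann_regular_of_lower_bound by simp
  qed
  then show ?thesis
    using isCont_quadratic_conorm_of_zero isCont_quadratic_conorm_of_bp
      bp_quasi_invertible_of_isCont[OF assms(2)]
    unfolding von_neumann_regular_def Q_op_def by metis
qed

end
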